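(* Let $H$ be a reduced linear hypergraph of rank 3. The following two assertions are equivalent: \begin{enumerate} \item[(1)] Avoider wins on $H$ as last player. \item[(2)] Each connected component of $H$ is a cycle, a prism, an isolated 2-edge or an isolated vertex. \end{enumerate}
   Context: A hypergraph $H$ has a finite vertex set $V(H)$ and an edge set $E(H)\subseteq 2^{V(H)}$ (the empty edge is allowed). In the Avoider-Enforcer game on $H$, two players, Avoider and Enforcer, alternately pick one previously unpicked vertex of $H$ until all vertices have been picked. Enforcer wins if at the end Avoider has picked all the vertices of some edge of $H$; otherwise Avoider wins (in particular Enforcer wins if $\varnothing\in E(H)$). The last player is the player who makes the last move of the game: this is the first player if $|V(H)|$ is odd and the second player if $|V(H)|$ is even. "Avoider wins on $H$ as last player" means Avoider has a winning strategy when she is the last player. A $k$-edge is an edge with exactly $k$ vertices. $H$ has rank 3 if all its edges have at most 3 vertices. $H$ is linear if any two distinct edges share at most one vertex. The degree of a vertex is the number of edges containing it. A leaf-edge is an edge with at most one vertex of degree greater than 1. A hypergraph of rank 3 is reduced if it contains no leaf-edge of size 3. A subhypergraph of $H$ is a hypergraph $H'$ with $V(H')\subseteq V(H)$, $E(H')\subseteq E(H)$. A walk in $H$ is a sequence $(e_1,\ldots,e_\ell)$ of edges with $e_i\cap e_{i+1}\neq\varnothing$ for $1\le i\le \ell-1$; it is simple if $e_i\cap e_j=\varnothing$ whenever $|i-j|\ge 2$. It is linear if its (distinct) edges pairwise share at most one vertex. $H$ is connected if for all distinct $a,b\in V(H)$ there is a walk $(e_1,\ldots,e_\ell)$ in $H$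 with $a\in e_1$, $b\in e_\ell$. Connected components are the maximal connected subhypergraphs. For distinct vertices $a,b$, an $ab$-chain is a hypergraph $P$ formed by the edges (and their vertices) of a linear simple walk $(e_1,\ldots,e_\ell)$ with all $|e_i|=3$, such that $e_1$ is the only edge containing $a$ and $e_\ell$ is the only edge containing $b$; its length is $\ell\ge 1$. A cycle is a hypergraph obtained from an $ab$-chain $P$ of length at least 2 by adding a 3-edge $\{a,b,c\}$ where $c\notin V(P)$ is a new vertex; its length is its number of edges (at least 3). The prism is the hypergraph obtained from a cycle of length 3 by adding a 3-edge consisting of its three vertices of degree 1 (so it has 6 vertices and 4 edges). An isolated 2-edge is a hypergraph with two vertices and a single edge containing both. An isolated vertex is a hypergraph with one vertex and no edge. *)

theory Defs
  imports Main
begin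

record 'a hypergraph =
  verts :: "'a set"
  edges :: "'a set set"

definition hypergraph :: "'a hypergraph \<Rightarrow> bool" where
  "hypergraph H \<longleftrightarrow> finite (verts H) \<and> edges H \<subseteq> Pow (verts H)"

definition rank3 :: "'a hypergraph \<Rightarrow> bool" where
  "rank3 H \<longleftrightarrow> (\<forall>e\<in>edges H. card e \<le> 3)"

definition linear_edges :: "'a set set \<Rightarrow> bool" where
  "linear_edges F \<longleftrightarrow> (\<forall>e\<in>F. \<forall>f\<in>F. e \<noteq> f \<longrightarrow> card (e \<inter> f) \<le> 1)"

definition linear_hypergraph :: "'a hypergraph \<Rightarrow> bool" where
  "linear_hypergraph H \<longleftrightarrow> linear_edges (edges H)"

definition vdegree :: "'a hypergraph \<Rightarrow> 'a \<Rightarrow> nat" where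
  "vdegree H v = card {e \<in> edges H. v \<in> e}"

definition leaf_edge :: "'a hypergraph \<Rightarrow> 'a set \<Rightarrow> bool" where
  "leaf_edge H e \<longleftrightarrow> e \<in> edges H \<and> card {v \<in> e. vdegree H v > 1} \<le> 1"

definition reduced :: "'a hypergraph \<Rightarrow> bool" where
  "reduced H \<longleftrightarrow> \<not> (\<exists>e. leaf_edge H e \<and> card e = 3)"

definition subhypergraph :: "'a hypergraph \<Rightarrow> 'a hypergraph \<Rightarrow> bool" where
  "subhypergraph H' H \<longleftrightarrow> hypergraph H' \<and> verts H' \<subseteq> verts H \<and> edges H' \<subseteq> edges H"

definition walk :: "'a hypergraph \<Rightarrow> 'a set list \<Rightarrow> bool" where
  "walk H es \<longleftrightarrow> es \<noteq> [] \<and> set es \<subseteq> edges H \<and>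
     (\<forall>i. Suc i < length es \<longrightarrow> es ! i \<inter> es ! Suc i \<noteq> {})"

definition simple_walk :: "'a hypergraph \<Rightarrow> 'a set list \<Rightarrow> bool" where
  "simple_walk H es \<longleftrightarrow> walk H es \<and>
     (\<forall>i j. j < length es \<and> i + 2 \<le> j \<longrightarrow> es ! i \<inter> es ! j = {})"

text \<open>A simple walk could still repeat an edge consecutively, hence the explicit
  distinctness requirement for linear walks.\<close>

definition linear_walk :: "'a hypergraph \<Rightarrow> 'a set list \<Rightarrow> bool" where
  "linear_walk H es \<longleftrightarrow> walk H es \<and> distinct es \<and> linear_edges (set es)"

definition connected_hypergraph :: "'a hypergraph \<Rightarrow> bool" where
  "connected_hypergraph H \<longleftrightarrow>
     (\<forall>a\<in>verts H. \<forall>b\<in>verts H. a \<noteq> b \<longrightarrow>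
        (\<exists>es. walk H es \<and> a \<in> hd es \<and> b \<in> last es))"

text \<open>The hypergraph without vertices and edges is vacuously connected; it is not counted
  as a component. This only matters when \<open>H\<close> itself is that hypergraph: otherwise a single
  vertex or the empty edge shows that it is not maximal.\<close>

definition connected_component :: "'a hypergraph \<Rightarrow> 'a hypergraph \<Rightarrow> bool" where
  "connected_component H C \<longleftrightarrow>
     \<not> (verts C = {} \<and> edges C = {}) \<and>
     subhypergraph C H \<and> connected_hypergraph C \<and>
     (\<forall>D. subhypergraph D H \<and> connected_hypergraph D \<and> subhypergraph C D \<longrightarrow> D = C)"

definition chain_between :: "'a \<Rightarrow> 'a \<Rightarrow> nat \<Rightarrow> 'a hypergraph \<Rightarrow> bool" where
  "chain_between a b l P \<longleftrightarrow> a \<noteq> b \<and>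
     (\<exists>es. length es = l \<and> edges P = set es \<and> verts P = \<Union>(set es) \<and>
           simple_walk P es \<and> linear_walk P es \<and> (\<forall>e\<in>set es. card e = 3) \<and>
           {e \<in> edges P. a \<in> e} = {hd es} \<and> {e \<in> edges P. b \<in> e} = {last es})"

definition is_cycle :: "'a hypergraph \<Rightarrow> bool" where
  "is_cycle C \<longleftrightarrow>
     (\<exists>a b c l P. chain_between a b l P \<and> 2 \<le> l \<and> c \<notin> verts P \<and>
        C = \<lparr>verts = insert c (verts P), edges = insert {a, b, c} (edges P)\<rparr>)"

definition is_prism :: "'a hypergraph \<Rightarrow> bool" where
  "is_prism Q \<longleftrightarrow>
     (\<exists>C. is_cycle C \<and> card (edges C) = 3 \<and>
        Q = \<lparr>verts = verts C,
             edges = insert {v \<in> verts C. vdegree C v = 1} (edges C)\<rparr>)"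

definition is_isolated_2_edge :: "'a hypergraph \<Rightarrow> bool" where
  "is_isolated_2_edge C \<longleftrightarrow> (\<exists>a b. a \<noteq> b \<and> C = \<lparr>verts = {a, b}, edges = {{a, b}}\<rparr>)"

definition is_isolated_vertex :: "'a hypergraph \<Rightarrow> bool" where
  "is_isolated_vertex C \<longleftrightarrow> (\<exists>a. C = \<lparr>verts = {a}, edges = {}\<rparr>)"

datatype player = Avoider | Enforcer

fun opponent :: "player \<Rightarrow> player" where
  "opponent Avoider = Enforcer"
| "opponent Enforcer = Avoider"

text \<open>Moves are numbered from 0, and \<open>p\<close> is the player who makes move 0. A (partial) play
  is the list of the vertices picked so far, in order.\<close>

definition mover :: "player \<Rightarrow> nat \<Rightarrow> player" where
  "mover p i = (if even i then p else opponent p)"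

definition last_player :: "player \<Rightarrow> 'a hypergraph \<Rightarrow> player" where
  "last_player p H = (if odd (card (verts H)) then p else opponent p)"

definition partial_play :: "'a hypergraph \<Rightarrow> 'a list \<Rightarrow> bool" where
  "partial_play H xs \<longleftrightarrow> distinct xs \<and> set xs \<subseteq> verts H"

definition complete_play :: "'a hypergraph \<Rightarrow> 'a list \<Rightarrow> bool" where
  "complete_play H xs \<longleftrightarrow> distinct xs \<and> set xs = verts H"

definition picked_by :: "player \<Rightarrow> player \<Rightarrow> 'a list \<Rightarrow> 'a set" where
  "picked_by q p xs = {xs ! i | i. i < length xs \<and> mover p i = q}"

definition enforcer_wins_play :: "player \<Rightarrow> 'a hypergraph \<Rightarrow> 'a list \<Rightarrow> bool" where
  "enforcer_wins_play p H xs \<longleftrightarrow> (\<exists>e\<in>edges H. e \<subseteq> picked_by Avoider p xs)"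

definition avoider_strategy :: "player \<Rightarrow> 'a hypergraph \<Rightarrow> ('a list \<Rightarrow> 'a) \<Rightarrow> bool" where
  "avoider_strategy p H \<sigma> \<longleftrightarrow>
     (\<forall>xs. partial_play H xs \<and> \<not> complete_play H xs \<and> mover p (length xs) = Avoider
        \<longrightarrow> \<sigma> xs \<in> verts H - set xs)"

definition follows_avoider_strategy :: "player \<Rightarrow> ('a list \<Rightarrow> 'a) \<Rightarrow> 'a list \<Rightarrow> bool" where
  "follows_avoider_strategy p \<sigma> xs \<longleftrightarrow>
     (\<forall>i<length xs. mover p i = Avoider \<longrightarrow> xs ! i = \<sigma> (take i xs))"

definition avoider_wins :: "player \<Rightarrow> 'a hypergraph \<Rightarrow> bool" where
  "avoider_wins p H \<longleftrightarrow>
     (\<exists>\<sigma>. avoider_strategy p H \<sigma> \<and>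
        (\<forall>xs. complete_play H xs \<and> follows_avoider_strategy p \<sigma> xs
           \<longrightarrow> \<not> enforcer_wins_play p H xs))"

text \<open>Exactly one choice of the first player \<open>p\<close> makes Avoider the last player.\<close>

definition avoider_wins_as_last :: "'a hypergraph \<Rightarrow> bool" where
  "avoider_wins_as_last H \<longleftrightarrow> (\<exists>p. last_player p H = Avoider \<and> avoider_wins p H)"

end

theory Submission
  imports Defs
begin

text \<open>
  Write a position as the set \<open>V\<close> of unpicked vertices together with the residual edges (edges
  touched by Enforcer deleted, the others shrunk by Avoider's vertices). Winning positions of
  Avoider as last player are closed under deleting vertices and under disjoint unions, so cycles
  (each edge gets its own pair of vertices) and prisms (one Enforcer move leaves two edges that
  admit such pairs) are fine.

  Conversely, every connected subfamily of a winning position has to be winning. Two connected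
  2-edges, or one 2-edge in a connected family with an odd number of vertices, lose: on an odd
  number of vertices Avoider must move, and any move creates a 1-edge or a second 2-edge connected
  to the first. Hence a component with a 2-edge and a further edge has a leaf-edge of size 3. In
  the 3-uniform case the same argument shows that a connected subfamily with \<open>m\<close> edges and an odd
  number of vertices has exactly \<open>2 m + 1\<close> vertices, that is, it is a hypertree. This alone forces
  a connected family without leaf-edges to be a cycle or a prism, by induction on the number of
  edges: remove an edge \<open>g\<close> keeping the rest connected; either the rest is a hypertree and \<open>g\<close>
  closes a path, or \<open>g\<close> lies inside the vertex set of the rest.
\<close>

section \<open>The game on positions\<close>

text \<open>Deletion of vertices is allowed on either turn, so a connected subfamily
  \<open>G\<close> can be judged as a game on \<open>\<Union>G\<close> alone, whatever the parity of
  the whole board. Who moves there depends only on the parity of \<open>card (\<Union>G)\<close>;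
  this is what turns the game into counting.

  The counting compares a connected family with the same family without a removable edge
  \<open>g\<close>: the difference is the number of private vertices of \<open>g\<close>, those in
  no other edge. Parity immediately rules out exactly one private vertex where both counts must be
  even. The obstacle is an edge with none, whose removal leaves every count unchanged. It is
  overcome by exchanging it with a second removable edge \<open>h\<close>, where linearity
  guarantees that \<open>g\<close> covers at most one private vertex of \<open>h\<close>. The same
  exchange recurs in the final classification.

  The number \<open>2 m + 1\<close> arises as follows. After Avoider's move \<open>x\<close>, the
  edges through \<open>x\<close> are 2-edges and no two of them may be connected. So the family
  falls into separate branches at \<open>x\<close>, and inside a branch each added edge brings two
  new vertices.\<close>

text \<open>\<open>V\<close> is the set of unpicked vertices and \<open>F\<close> the set of residual edges. As Avoider makes the
  last move, it is her turn exactly if \<open>card V\<close> is odd. An edge not contained in \<open>V\<close> can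
  never be completed.\<close>

inductive aw :: "'a set \<Rightarrow> 'a set set \<Rightarrow> bool" where
  aw_empty: "{} \<notin> F \<Longrightarrow> aw {} F"
| aw_avoider: "odd (card V) \<Longrightarrow> x \<in> V \<Longrightarrow> aw (V - {x}) ((\<lambda>e. e - {x}) ` F) \<Longrightarrow> aw V F"
| aw_enforcer: "finite V \<Longrightarrow> V \<noteq> {} \<Longrightarrow> even (card V) \<Longrightarrow>
    (\<And>x. x \<in> V \<Longrightarrow> aw (V - {x}) {e \<in> F. x \<notin> e}) \<Longrightarrow> aw V F"

lemma aw_finite: "aw V F \<Longrightarrow> finite V"
  by (induction rule: aw.induct) auto

lemma aw_evenD:
  assumes "aw V F" "even (card V)" "x \<in> V"
  shows "aw (V - {x}) {e \<in> F. x \<notin> e}"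
  using assms by (auto elim: aw.cases)

lemma aw_oddE:
  assumes "aw V F" "odd (card V)"
  obtains x where "x \<in> V" "aw (V - {x}) ((\<lambda>e. e - {x}) ` F)"
  using assms by (auto elim: aw.cases)

text \<open>Completing an edge of \<open>F'\<close> would complete an edge of \<open>F\<close>
  inside it, so the same moves win. The one rule serves to drop edges, to enlarge them and to pass
  from pairs to the edges that contain them.\<close>

lemma aw_refine:
  assumes "aw V F" "\<And>e'. e' \<in> F' \<Longrightarrow> \<exists>e\<in>F. e \<subseteq> e'"
  shows "aw V F'"
  using assms
proof (induction arbitrary: F' rule: aw.induct)
  case (aw_empty F)
  then show ?case by (metis aw.aw_empty subset_empty)
next
  case (aw_avoider V x F)
  have "aw (V - {x}) ((\<lambda>e. e - {x}) ` F')"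
  proof (rule aw_avoider.IH)
    fix e' assume "e' \<in> (\<lambda>e. e - {x}) ` F'"
    then show "\<exists>e\<in>(\<lambda>e. e - {x}) ` F. e \<subseteq> e'"
      using aw_avoider.prems by (fastforce simp: image_iff)
  qed
  then show ?case using aw_avoider.hyps by (blast intro: aw.aw_avoider)
next
  case (aw_enforcer V F)
  have "aw (V - {x}) {e \<in> F'. x \<notin> e}" if "x \<in> V" for x
  proof (rule aw_enforcer.IH[OF that])
    fix e' assume "e' \<in> {e \<in> F'. x \<notin> e}"
    then show "\<exists>e\<in>{e \<in> F. x \<notin> e}. e \<subseteq> e'"
      using aw_enforcer.prems by blast
  qed
  then show ?case using aw_enforcer.hyps by (blast intro: aw.aw_enforcer)
qed

text \<open>Also true on Avoider's turn: replacing her winning move by an arbitrary move of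
  Enforcer does not hurt her, as she keeps her intended move in reserve.\<close>

lemma aw_delete:
  assumes "aw V F" "x \<in> V"
  shows "aw (V - {x}) {e \<in> F. x \<notin> e}"
  using assms
proof (induction "card V" arbitrary: V F x rule: less_induct)
  case less
  have fin: "finite V" using less.prems aw_finite by blast
  show ?case
  proof (cases "even (card V)")
    case True
    then show ?thesis using aw_evenD[OF less.prems(1) _ less.prems(2)] by blast
  next
    case odd: False
    then obtain y where y: "y \<in> V" "aw (V - {y}) ((\<lambda>e. e - {y}) ` F)"
      using aw_oddE[OF less.prems(1)] by blast
    show ?thesis
    proof (cases "y = x")
      case True
      show ?thesis
        using y(2) unfolding True by (rule aw_refine) (auto intro!: bexI)
    next
      case neq: False
      define F1 where "F1 = {e \<in> (\<lambda>e. e - {y}) ` F. x \<notin> e}"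
      have ev: "even (card (V - {y}))" using odd y(1) fin by simp
      have a1: "aw (V - {y} - {x}) F1"
        unfolding F1_def using aw_evenD[OF y(2) ev] less.prems(2) neq by blast
      have evx: "even (card (V - {x}))" using odd less.prems(2) fin by simp
      have oddxy: "odd (card (V - {x} - {z}))" if "z \<in> V - {x}" for z
        using evx card.remove[of "V - {x}" z] that fin by (metis even_Suc finite_Diff)
      have lt: "card (V - {y} - {x}) < card V"
        using fin y(1) by (intro psubset_card_mono) auto
      have "aw (V - {x} - {z}) {e \<in> {e \<in> F. x \<notin> e}. z \<notin> e}" if z: "z \<in> V - {x}" for z
      proof (cases "z = y")
        case True
        have "aw (V - {y} - {x}) {e \<in> {e \<in> F. x \<notin> e}. z \<notin> e}"
          by (rule aw_refine[OF a1]) (auto simp: F1_def True)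
        moreover have "V - {y} - {x} = V - {x} - {z}" using True by blast
        ultimately show ?thesis by simp
      next
        case False
        \<comment> \<open>Avoider answers \<open>z\<close> with the reserved \<open>y\<close>. The
          induction hypothesis removes \<open>z\<close> from the smaller position.\<close>
        have "aw (V - {y} - {x} - {z}) {e \<in> F1. z \<notin> e}"
          using less.hyps[OF lt a1] z False by blast
        moreover have "V - {y} - {x} - {z} = V - {x} - {z} - {y}" by blast
        ultimately have "aw (V - {x} - {z} - {y}) {e \<in> F1. z \<notin> e}" by simp
        then have "aw (V - {x} - {z} - {y}) ((\<lambda>e. e - {y}) ` {e \<in> {e \<in> F. x \<notin> e}. z \<notin> e})"
          by (rule aw_refine) (auto simp: F1_def)
        then show ?thesis
          using aw.aw_avoider[OF oddxy[OF z], of y] y(1) neq False by blast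
      qed
      moreover have "V - {x} \<noteq> {}" using y(1) neq by blast
      ultimately show ?thesis using aw.aw_enforcer[of "V - {x}"] evx fin by blast
    qed
  qed
qed

text \<open>Deleting all vertices of \<open>V - W\<close> one by one is possible because
  \<open>aw_delete\<close> ignores the turn; hence \<open>W\<close> may have either parity. Edges
  inside \<open>W\<close> survive.\<close>

lemma aw_restrict:
  assumes "aw V F" "W \<subseteq> V" "G \<subseteq> F" "\<And>e. e \<in> G \<Longrightarrow> e \<subseteq> W"
  shows "aw W G"
proof -
  have "aw (V - X) {e \<in> F. e \<inter> X = {}}" if "finite X" "X \<subseteq> V" for X
    using that
  proof induction
    case empty
    then show ?case using assms(1) by simp
  next
    case (insert x X)
    then have "aw (V - X - {x}) {e \<in> {e \<in> F. e \<inter> X = {}}. x \<notin> e}"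
      by (intro aw_delete) auto
    moreover have "V - X - {x} = V - insert x X" by blast
    ultimately have "aw (V - insert x X) {e \<in> {e \<in> F. e \<inter> X = {}}. x \<notin> e}" by simp
    then show ?case by (rule aw_refine) auto
  qed
  from this[of "V - W"] have "aw (V - (V - W)) {e \<in> F. e \<inter> (V - W) = {}}"
    using aw_finite[OF assms(1)] by simp
  moreover have "V - (V - W) = W" using assms(2) by blast
  ultimately have "aw W {e \<in> F. e \<inter> (V - W) = {}}" by simp
  then show ?thesis by (rule aw_refine) (use assms in blast)
qed

text \<open>On Avoider's turn exactly one side is odd, and her winning move on that side leaves the
  other intact. On Enforcer's turn both sides may be odd, so that his move comes out of turn on its
  side; \<open>aw_delete\<close> covers this.\<close>

lemma aw_Un:
  assumes "aw V F" "aw W G" "V \<inter> W = {}" "F \<subseteq> Pow V" "G \<subseteq> Pow W"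
  shows "aw (V \<union> W) (F \<union> G)"
  using assms
proof (induction "card V + card W" arbitrary: V F W G rule: less_induct)
  case less
  have fin: "finite V" "finite W" using less.prems aw_finite by blast+
  have card: "card (V \<union> W) = card V + card W"
    using card_Un_disjoint fin less.prems(3) by blast
  have av: "aw (A \<union> B) (P \<union> Q)"
    if A: "aw A P" "aw B Q" "A \<inter> B = {}" "P \<subseteq> Pow A" "Q \<subseteq> Pow B" "odd (card A)" "even (card B)"
      "card A + card B \<le> card V + card W" for A B :: "'a set" and P Q
  proof -
    obtain x where x: "x \<in> A" "aw (A - {x}) ((\<lambda>e. e - {x}) ` P)"
      using aw_oddE[OF A(1,6)] by blast
    have fin: "finite A" "finite B" using A aw_finite by blast+
    have "aw ((A - {x}) \<union> B) ((\<lambda>e. e - {x}) ` P \<union> Q)"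
    proof (rule less.hyps)
      show "card (A - {x}) + card B < card V + card W"
        using A(8) card_Diff1_less[OF fin(1) x(1)] by linarith
    qed (use x A in auto)
    moreover have "(A - {x}) \<union> B = (A \<union> B) - {x}" using x A by blast
    moreover have "(\<lambda>e. e - {x}) ` P \<union> Q = (\<lambda>e. e - {x}) ` (P \<union> Q)"
    proof -
      have "(\<lambda>e. e - {x}) ` Q = (\<lambda>e. e) ` Q"
        by (rule image_cong) (use x(1) A(3,5) in blast)+
      then show ?thesis by (simp add: image_Un)
    qed
    moreover have "odd (card (A \<union> B))"
      using A fin by (simp add: card_Un_disjoint)
    ultimately show ?thesis using x(1) aw.aw_avoider[of "A \<union> B" x "P \<union> Q"] by simp
  qed
  have en: "aw (A \<union> B - {x}) {e \<in> P \<union> Q. x \<notin> e}"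
    if A: "aw A P" "aw B Q" "A \<inter> B = {}" "P \<subseteq> Pow A" "Q \<subseteq> Pow B" "even (card A + card B)"
      "card A + card B = card V + card W" "x \<in> A" for A B :: "'a set" and P Q x
  proof -
    have fin: "finite A" "finite B" using A aw_finite by blast+
    have "aw (A - {x} \<union> B) ({e \<in> P. x \<notin> e} \<union> Q)"
    proof (rule less.hyps)
      show "card (A - {x}) + card B < card V + card W"
        using A(7) card_Diff1_less[OF fin(1) A(8)] by linarith
      show "aw (A - {x}) {e \<in> P. x \<notin> e}" by (rule aw_delete[OF A(1,8)])
    qed (use A in auto)
    moreover have "A - {x} \<union> B = A \<union> B - {x}" using A by blast
    moreover have "{e \<in> P. x \<notin> e} \<union> Q = {e \<in> P \<union> Q. x \<notin> e}" using A by blast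
    ultimately show ?thesis by simp
  qed
  show ?case
  proof (cases "odd (card V + card W)")
    case True
    then consider "odd (card V)" "even (card W)" | "even (card V)" "odd (card W)" by auto
    then show ?thesis
    proof cases
      case 1
      then show ?thesis using av[OF less.prems] by blast
    next
      case 2
      then have "aw (W \<union> V) (G \<union> F)" using av[of W G V F] less.prems by (simp add: Int_commute)
      then show ?thesis by (simp add: Un_commute)
    qed
  next
    case False
    show ?thesis
    proof (cases "V \<union> W = {}")
      case True
      then have "aw {} F" "aw {} G" using less.prems by auto
      then have "{} \<notin> F \<union> G" by (auto elim: aw.cases)
      then show ?thesis using True aw_empty by metis
    next
      case ne: False
      have "aw (V \<union> W - {x}) {e \<in> F \<union> G. x \<notin> e}" if "x \<in> V \<union> W" for x
      proof (cases "x \<in> V")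
        case True
        then show ?thesis using en[OF less.prems _ refl] False by blast
      next
        case xW: False
        then have "aw (W \<union> V - {x}) {e \<in> G \<union> F. x \<notin> e}"
          using en[of W G V F x] less.prems False that by (simp add: Int_commute add.commute[of "card W"])
        then show ?thesis by (simp add: Un_commute)
      qed
      then show ?thesis using aw.aw_enforcer[of "V \<union> W"] ne fin card False by auto
    qed
  qed
qed

lemma aw_no_edges: "finite V \<Longrightarrow> aw V {}"
proof (induction "card V" arbitrary: V)
  case 0
  then show ?case using aw_empty by auto
next
  case (Suc n)
  have *: "aw (V - {x}) {}" if "x \<in> V" for x
    using Suc that by simp
  have "V \<noteq> {}" using Suc by auto
  then obtain x where "x \<in> V" by blast
  show ?case
  proof (cases "odd (card V)")
    case True
    then show ?thesis using aw_avoider[of V x "{}"] * \<open>x \<in> V\<close> by simp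
  next
    case False
    then show ?thesis using aw_enforcer[of V "{}"] * \<open>V \<noteq> {}\<close> Suc.prems by simp
  qed
qed

text \<open>Restricted to a single vertex forming an edge, the game consists of one move, and
  Avoider has to make it.\<close>

lemma aw_edge_card:
  assumes "aw V F" "e \<in> F" "e \<subseteq> V"
  shows "card e \<ge> 2"
proof (rule ccontr)
  assume "\<not> card e \<ge> 2"
  have fin: "finite e" using assms aw_finite finite_subset by blast
  have aw: "aw e {e}" using aw_restrict[OF assms(1,3), of "{e}"] assms(2) by blast
  from \<open>\<not> card e \<ge> 2\<close> consider "card e = 0" | "card e = 1" by linarith
  then show False
  proof cases
    case 1
    then have "e = {}" using fin by simp
    then show False using aw by (auto elim: aw.cases)
  next
    case 2
    then obtain v where v: "e = {v}" using card_1_singletonE by blast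
    then have "aw ({v} - {v}) ((\<lambda>e. e - {v}) ` {e})"
      using aw_oddE[OF aw] by auto
    then show False using v by (auto elim: aw.cases)
  qed
qed

text \<open>With two vertices left Enforcer moves first and has to touch the edge. Together with
  \<open>aw_Un\<close> this is the source of all pairing strategies.\<close>

lemma aw_pair: "a \<noteq> b \<Longrightarrow> aw {a, b} {{a, b}}"
proof (rule aw_enforcer)
  fix x assume "a \<noteq> b" "x \<in> {a, b}"
  then have "{e \<in> {{a, b}}. x \<notin> e} = {}" by blast
  then show "aw ({a, b} - {x}) {e \<in> {{a, b}}. x \<notin> e}" by (metis aw_no_edges finite.emptyI finite_Diff finite_insert)
qed auto

lemma aw_big_edge:
  assumes "card e \<ge> 2"
  shows "aw e {e}"
proof -
  from assms obtain T where "T \<subseteq> e" "card T = 2" by (meson obtain_subset_with_card_n)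
  then obtain a b where ab: "a \<noteq> b" "{a, b} \<subseteq> e" by (auto simp: card_2_iff)
  have "finite e" using assms by (intro card_ge_0_finite) linarith
  then have "aw ({a, b} \<union> (e - {a, b})) ({{a, b}} \<union> {})"
    by (intro aw_Un aw_pair aw_no_edges) (use ab in auto)
  moreover have "{a, b} \<union> (e - {a, b}) = e" using ab by blast
  ultimately have "aw e ({{a, b}} \<union> {})" by simp
  then show ?thesis by (rule aw_refine) (use ab in auto)
qed

section \<open>Connected edge families\<close>

text \<open>Connectedness by cuts instead of walks, which suits adding and removing single edges;
  \<open>conn_walk\<close> and \<open>conn_obtains_walk\<close> translate.\<close>

definition conn :: "'a set set \<Rightarrow> bool" where
  "conn F \<longleftrightarrow> F \<noteq> {} \<and> (\<forall>P. P \<subset> F \<and> P \<noteq> {} \<longrightarrow> (\<exists>e\<in>F - P. e \<inter> \<Union>P \<noteq> {}))"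

lemma conn_nonempty: "conn F \<Longrightarrow> F \<noteq> {}"
  by (simp add: conn_def)

lemma conn_single [simp]: "conn {e}"
  by (auto simp: conn_def)

lemma connD:
  assumes "conn F" "P \<subset> F" "P \<noteq> {}"
  obtains e where "e \<in> F" "e \<notin> P" "e \<inter> \<Union>P \<noteq> {}"
  using assms unfolding conn_def by blast

lemma conn_Un:
  assumes A: "conn A" and B: "conn B" and AB: "\<Union>A \<inter> \<Union>B \<noteq> {}"
  shows "conn (A \<union> B)"
  unfolding conn_def
proof (intro conjI allI impI)
  show "A \<union> B \<noteq> {}" using A conn_nonempty by blast
  fix P assume P: "P \<subset> A \<union> B \<and> P \<noteq> {}"
  show "\<exists>e\<in>A \<union> B - P. e \<inter> \<Union>P \<noteq> {}"
  proof -
    consider "P \<inter> A \<subset> A" "P \<inter> A \<noteq> {}" | "P \<inter> B \<subset> B" "P \<inter> B \<noteq> {}" | "P = A" "P \<inter> B = {}"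
      | "P = B" "P \<inter> A = {}"
      using P by blast
    then show ?thesis
    proof cases
      case 1
      show ?thesis by (rule connD[OF A 1]) blast
    next
      case 2
      show ?thesis by (rule connD[OF B 2]) blast
    next
      case 3
      then show ?thesis using AB by blast
    next
      case 4
      then show ?thesis using AB by blast
    qed
  qed
qed

lemma conn_insert: "conn Q \<Longrightarrow> e \<inter> \<Union>Q \<noteq> {} \<Longrightarrow> conn (insert e Q)"
  using conn_Un[of "{e}" Q] by simp

lemma conn_meets:
  assumes "conn F" "g \<in> F" "F - {g} \<noteq> {}"
  shows "g \<inter> \<Union>(F - {g}) \<noteq> {}"
  by (rule connD[OF assms(1), of "F - {g}"]) (use assms in blast)+

lemma maximal_conn:
  assumes "finite S" "P \<in> S" "conn P" "finite P"
  obtains Q where "P \<subseteq> Q" "Q \<in> S" "conn Q" "\<And>R. R \<in> S \<Longrightarrow> conn R \<Longrightarrow> Q \<subseteq> R \<Longrightarrow> R = Q"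
proof -
  have "finite {Q \<in> S. conn Q}" "P \<in> {Q \<in> S. conn Q}" using assms by auto
  from finite_has_maximal2[OF this] show ?thesis using that by (metis (mono_tags, lifting) mem_Collect_eq)
qed

text \<open>A maximal connected proper subfamily containing \<open>P\<close> misses only one edge:
  some outside edge meets it, and adding that edge must exhaust \<open>F\<close>.\<close>

lemma conn_removable:
  assumes "finite F" "conn F" "conn P" "P \<subset> F"
  obtains g where "g \<in> F" "g \<notin> P" "conn (F - {g})" "P \<subseteq> F - {g}"
proof -
  have "finite {Q. Q \<subset> F}" by (rule finite_subset[of _ "Pow F"]) (use assms(1) in auto)
  then obtain Q where Q: "P \<subseteq> Q" "Q \<subset> F" "conn Q"
    "\<And>R. R \<subset> F \<Longrightarrow> conn R \<Longrightarrow> Q \<subseteq> R \<Longrightarrow> R = Q"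
    using maximal_conn[of "{Q. Q \<subset> F}" P] assms finite_subset by (metis mem_Collect_eq psubset_imp_subset)
  obtain g where g: "g \<in> F" "g \<notin> Q" "g \<inter> \<Union>Q \<noteq> {}"
    using connD[OF assms(2) Q(2)] conn_nonempty[OF Q(3)] by metis
  have "conn (insert g Q)" using Q(3) g(3) by (rule conn_insert)
  then have "insert g Q = F" using Q(2) Q(4)[of "insert g Q"] g by blast
  then have "F - {g} = Q" using g by blast
  then show ?thesis using that[of g] g Q by auto
qed

text \<open>The set \<open>g - \<Union>(F - {g})\<close> consists of the private vertices of
  \<open>g\<close>; all later counts go through it.\<close>

lemma card_Union_remove:
  assumes "finite (\<Union>F)" "g \<in> F"
  shows "card (\<Union>F) = card (\<Union>(F - {g})) + card (g - \<Union>(F - {g}))"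
proof -
  have "\<Union>F = \<Union>(F - {g}) \<union> (g - \<Union>(F - {g}))" using assms(2) by blast
  moreover have "card (\<Union>(F - {g}) \<union> (g - \<Union>(F - {g}))) = card (\<Union>(F - {g})) + card (g - \<Union>(F - {g}))"
    by (rule card_Un_disjoint) (use assms in \<open>auto intro: rev_finite_subset\<close>)
  ultimately show ?thesis by simp
qed

lemma private_less:
  assumes "conn F" "g \<in> F" "F - {g} \<noteq> {}" "finite g"
  shows "card (g - \<Union>(F - {g})) < card g"
  using conn_meets[OF assms(1-3)] assms(4) by (intro psubset_card_mono) auto

lemma linear_edgesD:
  "linear_edges F \<Longrightarrow> e \<in> F \<Longrightarrow> f \<in> F \<Longrightarrow> e \<noteq> f \<Longrightarrow> card (e \<inter> f) \<le> 1"
  by (simp add: linear_edges_def)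

lemma linear_edges_subset: "linear_edges F \<Longrightarrow> G \<subseteq> F \<Longrightarrow> linear_edges G"
  unfolding linear_edges_def by blast

lemma linear_eqI:
  assumes "linear_edges F" "e \<in> F" "f \<in> F" "finite e" "x \<in> e" "y \<in> e" "x \<in> f" "y \<in> f" "x \<noteq> y"
  shows "e = f"
proof (rule ccontr)
  assume "e \<noteq> f"
  have "card {x, y} \<le> card (e \<inter> f)" by (rule card_mono) (use assms in auto)
  then show False using linear_edgesD[OF assms(1-3) \<open>e \<noteq> f\<close>] assms(9) by simp
qed

text \<open>Built up along removable edges, each new edge shares a vertex with the earlier ones and
  brings at most two more. Equality describes the hypertrees.\<close>

lemma conn_card_Union_le:
  assumes "finite F" "conn F" "\<And>e. e \<in> F \<Longrightarrow> card e = 3"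
  shows "card (\<Union>F) \<le> 2 * card F + 1"
  using assms
proof (induction "card F" arbitrary: F rule: less_induct)
  case less
  have fin: "finite (\<Union>F)" using less.prems by (metis card.infinite finite_Union zero_neq_numeral)
  obtain e where e: "e \<in> F" using less.prems conn_nonempty by blast
  show ?case
  proof (cases "F = {e}")
    case True
    then show ?thesis using less.prems by simp
  next
    case False
    obtain g where g: "g \<in> F" "g \<notin> {e}" "conn (F - {g})"
      using conn_removable[OF less.prems(1,2), of "{e}"] e False by (metis conn_single empty_subsetI insert_subset psubsetI)
    have "card (\<Union>(F - {g})) \<le> 2 * card (F - {g}) + 1"
      using less g by (metis Diff_iff card_Diff1_less finite_Diff)
    moreover have "card F = Suc (card (F - {g}))" using card.remove[OF less.prems(1) g(1)] .
    moreover have "card (g - \<Union>(F - {g})) < 3"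
      using private_less[OF less.prems(2) g(1) conn_nonempty[OF g(3)]] less.prems(3)[OF g(1)]
      by (metis card.infinite zero_neq_numeral)
    moreover have "card (\<Union>F) = card (\<Union>(F - {g})) + card (g - \<Union>(F - {g}))"
      using card_Union_remove[OF fin g(1)] .
    ultimately show ?thesis by linarith
  qed
qed

text \<open>In a smallest connected subfamily containing both edges, \<open>v\<close> is the
  removable one and has exactly one private vertex. The subfamilies with and without
  \<open>v\<close> differ by one vertex, so one of them is odd.\<close>

lemma two_2_edges:
  assumes "finite F" "linear_edges F" "conn F" "u \<in> F" "v \<in> F" "u \<noteq> v" "card u = 2" "card v = 2"
    "\<And>e. e \<in> F \<Longrightarrow> finite e"
  obtains G where "G \<subseteq> F" "conn G" "u \<in> G" "odd (card (\<Union>G))"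
proof -
  define S where "S = {G. G \<subseteq> F \<and> conn G \<and> u \<in> G \<and> v \<in> G}"
  have "F \<in> S" using assms unfolding S_def by blast
  then obtain G where G: "G \<in> S" "\<And>H. H \<in> S \<Longrightarrow> card G \<le> card H"
    using ex_has_least_nat[of "\<lambda>G. G \<in> S" F card] by blast
  then have Gs: "G \<subseteq> F" "conn G" "u \<in> G" "v \<in> G" unfolding S_def by auto
  have finG: "finite G" using Gs assms(1) finite_subset by blast
  have finU: "finite (\<Union>G)" using finG Gs(1) assms(9) by blast
  have min: "\<not> (H \<subset> G \<and> conn H \<and> u \<in> H \<and> v \<in> H)" for H
  proof
    assume H: "H \<subset> G \<and> conn H \<and> u \<in> H \<and> v \<in> H"
    then have "H \<in> S" using Gs unfolding S_def by blast
    then show False using G(2) H psubset_card_mono[OF finG] by (meson leD)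
  qed
  have "{u} \<subset> G" using Gs assms(6) by blast
  then obtain g where g: "g \<in> G" "g \<notin> {u}" "conn (G - {g})"
    using conn_removable[OF finG Gs(2), of "{u}"] by auto
  have "g = v" using min[of "G - {g}"] g Gs by blast
  define Q where "Q = G - {v}"
  have Q: "conn Q" "u \<in> Q" "v \<notin> Q" "insert v Q = G" using g \<open>g = v\<close> Q_def Gs assms(6) by auto
  have card: "card (\<Union>G) = card (\<Union>Q) + card (v - \<Union>Q)"
    unfolding Q_def by (rule card_Union_remove[OF finU Gs(4)])
  have "card (v - \<Union>Q) < 2"
    using private_less[OF Gs(2,4)] Q assms(8,9) Gs unfolding Q_def by auto
  \<comment> \<open>Without a private vertex, \<open>v\<close> would either stay attached after
    dropping a further removable edge \<open>h\<close>, against minimality, or lie inside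
    \<open>h\<close>, against linearity.\<close>
  moreover have "v - \<Union>Q \<noteq> {}"
  proof
    assume "v - \<Union>Q = {}"
    then have vQ: "v \<subseteq> \<Union>Q" by blast
    have "Q \<noteq> {u}"
    proof
      assume "Q = {u}"
      then have "v \<subseteq> u" using vQ by simp
      then show False using assms(4-9) by (metis card_subset_eq)
    qed
    then have "{u} \<subset> Q" using Q by blast
    then obtain h where h: "h \<in> Q" "h \<notin> {u}" "conn (Q - {h})"
      using conn_removable[of Q "{u}"] Q finG by (metis conn_single finite_insert)
    show False
    proof (cases "v \<inter> \<Union>(Q - {h}) = {}")
      case True
      then have "v \<subseteq> h" using vQ by blast
      then have "v \<inter> h = v" by blast
      moreover have "card (v \<inter> h) \<le> 1"
        using linear_edgesD[OF assms(2), of v h] h Q Gs by blast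
      ultimately show False using assms(8) by simp
    next
      case False
      then have "conn (insert v (Q - {h}))" using conn_insert h by blast
      moreover have "insert v (Q - {h}) \<subset> G"
        using h(1) Q(3) Q(4) by auto
      ultimately show False using min[of "insert v (Q - {h})"] h(2) Q(2) by blast
    qed
  qed
  then have "card (v - \<Union>Q) \<noteq> 0" using assms(5,9) by simp
  ultimately have "card (\<Union>G) = Suc (card (\<Union>Q))" using card by linarith
  then show ?thesis using that[of Q] that[of G] Q Gs by (metis even_Suc subset_insertI subset_trans)
qed

text \<open>An edge closing a hypercycle would be hit twice by what remains; exchanging it with
  another removable edge shows that this never happens.\<close>

lemma pendant_edge:
  assumes "finite F" "linear_edges F" "conn F" "u \<in> F" "card u = 2"
    "\<And>e. e \<in> F - {u} \<Longrightarrow> card e = 3"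
    "\<And>G. G \<subseteq> F \<Longrightarrow> conn G \<Longrightarrow> u \<in> G \<Longrightarrow> even (card (\<Union>G))"
    "g \<in> F - {u}" "conn (F - {g})"
  shows "card (g - \<Union>(F - {g})) \<ge> 2"
  using assms
proof (induction "card F" arbitrary: F g rule: less_induct)
  case less
  note lin = less.prems(2) and ev = less.prems(7)
  have fine: "finite e" if "e \<in> F" for e
    using that less.prems(5,6) by (cases "e = u") (force intro: card_ge_0_finite)+
  have finU: "finite (\<Union>F)" using less.prems(1) fine by blast
  have g: "g \<in> F" "g \<noteq> u" "card g = 3" using less.prems by auto
  define R where "R = F - {g}"
  have R: "conn R" "u \<in> R" "g \<notin> R" "insert g R = F" using less.prems R_def by auto
  have RF: "R \<subseteq> F" unfolding R_def by blast
  \<comment> \<open>Both \<open>F\<close> and \<open>F - {h}\<close> are connected and contain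
    \<open>u\<close>, so both have an even number of vertices.\<close>
  have evpriv: "even (card (h - \<Union>(F - {h})))" if "h \<in> F" "h \<noteq> u" "conn (F - {h})" for h
    using card_Union_remove[OF finU that(1)] ev[of F] ev[of "F - {h}"] that less.prems(3,4)
    by (metis Diff_iff Diff_subset even_add order_refl singletonD)
  show ?case
  proof (rule ccontr)
    assume "\<not> card (g - \<Union>(F - {g})) \<ge> 2"
    moreover have "even (card (g - \<Union>(F - {g})))" using evpriv g less.prems(9) by blast
    ultimately have "card (g - \<Union>(F - {g})) = 0" by presburger
    then have gR: "g \<subseteq> \<Union>R" using fine g unfolding R_def by auto
    have "R \<noteq> {u}"
    proof
      assume Ru: "R = {u}"
      have "g \<subseteq> u" using gR unfolding Ru by simp
      then have "card g \<le> card u" using fine less.prems(4) card_mono by blast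
      then show False using g less.prems(5) by simp
    qed
    then have "{u} \<subset> R" using R by blast
    then obtain h where h: "h \<in> R" "h \<noteq> u" "conn (R - {h})"
      using conn_removable[of R "{u}"] R less.prems(1) by (metis conn_single finite_insert insertCI)
    have hF: "h \<in> F" "h \<noteq> g" "card h = 3" using h R less.prems(6) by blast+
    have lt: "card R < card F" using R less.prems(1) by (metis R_def card_Diff1_less g(1))
    have "card (h - \<Union>(R - {h})) \<ge> 2"
    proof (rule less.hyps[OF lt])
      show "linear_edges R" using linear_edges_subset[OF lin RF] .
      show "finite R" using less.prems(1) RF finite_subset by blast
      show "card e = 3" if "e \<in> R - {u}" for e using less.prems(6)[of e] that RF by blast
      show "even (card (\<Union>G))" if "G \<subseteq> R" "conn G" "u \<in> G" for G
        using ev[OF order_trans[OF that(1) RF] that(2,3)] .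
    qed (use R(1,2) h less.prems(5) in blast)+
    moreover have "card (h - \<Union>(R - {h})) < 3"
      using private_less[OF R(1) h(1) conn_nonempty[OF h(3)]] hF(3) fine[OF hF(1)] by simp
    ultimately have hpriv: "card (h - \<Union>(R - {h})) = 2" by linarith
    have gh: "card (g \<inter> h) \<le> 1" using linear_edgesD[OF lin] g hF by blast
    have "g \<inter> \<Union>(R - {h}) \<noteq> {}"
    proof
      assume "g \<inter> \<Union>(R - {h}) = {}"
      then have "g \<inter> h = g" using gR by blast
      then show False using gh g by simp
    qed
    then have "conn (insert g (R - {h}))" using h(3) conn_insert by blast
    moreover have Fh: "insert g (R - {h}) = F - {h}" using g(1) hF(2) unfolding R_def by blast
    ultimately have cFh: "conn (F - {h})" by simp
    \<comment> \<open>By linearity \<open>g\<close> covers at most one of the two private vertices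
      that \<open>h\<close> has in \<open>R\<close>; by parity it then covers none.\<close>
    have split: "h - \<Union>(F - {h}) = (h - \<Union>(R - {h})) - (g \<inter> h)" unfolding Fh[symmetric] by blast
    have "card (h - \<Union>(F - {h})) \<ge> 1"
      unfolding split using diff_card_le_card_Diff[of "g \<inter> h" "h - \<Union>(R - {h})"] fine hF gh hpriv by (simp add: finite_Int)
    moreover have "even (card (h - \<Union>(F - {h})))" using evpriv hF h cFh by blast
    ultimately have "card (h - \<Union>(F - {h})) \<ge> 2" by presburger
    then have same: "h - \<Union>(F - {h}) = h - \<Union>(R - {h})"
      using card_seteq[of "h - \<Union>(R - {h})" "h - \<Union>(F - {h})"] hpriv fine hF split by (simp add: Diff_subset)
    have "g \<subseteq> \<Union>(R - {h})"
    proof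
      fix y assume y: "y \<in> g"
      then have "y \<notin> h - \<Union>(F - {h})" using g(1) hF(2) by blast
      then have "y \<notin> h - \<Union>(R - {h})" unfolding same .
      then show "y \<in> \<Union>(R - {h})" using y gR by blast
    qed
    moreover have "F - {h} - {g} = R - {h}" unfolding R_def by blast
    \<comment> \<open>Second use of the induction hypothesis, with the roles exchanged:
      \<open>g\<close> is removable from \<open>F - {h}\<close>, yet has no private vertex
      there.\<close>
    moreover have "card (g - \<Union>(F - {h} - {g})) \<ge> 2"
    proof (rule less.hyps)
      show "card (F - {h}) < card F" using hF less.prems(1) by (metis card_Diff1_less)
      show "linear_edges (F - {h})" using linear_edges_subset[OF lin] by blast
      show "conn (F - {h} - {g})" using \<open>F - {h} - {g} = R - {h}\<close> h by simp
      show "finite (F - {h})" using less.prems(1) by blast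
      show "card e = 3" if "e \<in> F - {h} - {u}" for e using less.prems(6)[of e] that by blast
      show "even (card (\<Union>G))" if "G \<subseteq> F - {h}" "conn G" "u \<in> G" for G
        using ev[OF order_trans[OF that(1) Diff_subset] that(2,3)] .
    qed (use cFh h(2) hF(2) g(1,2) less.prems(4,5) in blast)+
    ultimately show False by (metis Diff_eq_empty_iff card.empty not_numeral_le_zero)
  qed
qed

section \<open>Connected subfamilies of winning positions\<close>

abbreviation shrink :: "'a \<Rightarrow> 'a set set \<Rightarrow> 'a set set" where
  "shrink x F \<equiv> (\<lambda>e. e - {x}) ` F"

lemma linear_edges_shrink:
  assumes "linear_edges F" "\<And>e. e \<in> F \<Longrightarrow> finite e"
  shows "linear_edges (shrink x F)"
  unfolding linear_edges_def
proof (intro ballI impI)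
  fix e' f' assume "e' \<in> shrink x F" "f' \<in> shrink x F" "e' \<noteq> f'"
  then obtain e f where ef: "e \<in> F" "f \<in> F" "e \<noteq> f" "e' = e - {x}" "f' = f - {x}" by blast
  then have "card (e' \<inter> f') \<le> card (e \<inter> f)" using assms(2) by (intro card_mono) auto
  then show "card (e' \<inter> f') \<le> 1" using linear_edgesD[OF assms(1) ef(1-3)] by linarith
qed

lemma shrink_id:
  assumes "W \<subseteq> F" "\<And>h. h \<in> W \<Longrightarrow> x \<notin> h"
  shows "W \<subseteq> shrink x F"
proof
  fix h assume "h \<in> W"
  then have "h = h - {x}" "h \<in> F" using assms by auto
  then show "h \<in> shrink x F" by (rule image_eqI)
qed

text \<open>A shortest route inside \<open>R\<close> from \<open>p\<close> to \<open>x\<close> survives when \<open>x\<close> is shrunk away; it then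
  ends in the shrunk edge \<open>e - {x}\<close>.\<close>

lemma conn_shrink_reach:
  assumes "finite R" "conn R" "x \<in> \<Union>R" "p \<in> \<Union>R" "p \<noteq> x"
  obtains e W where "e \<in> R" "x \<in> e" "W \<subseteq> R" "\<And>h. h \<in> W \<Longrightarrow> x \<notin> h"
    "conn (insert (e - {x}) W)" "p \<in> \<Union>(insert (e - {x}) W)"
proof (cases "\<exists>e\<in>R. x \<in> e \<and> p \<in> e")
  case True
  then obtain e where "e \<in> R" "x \<in> e" "p \<in> e" by blast
  then show ?thesis using that[of e "{}"] assms(5) by auto
next
  case False
  obtain h where h: "h \<in> R" "p \<in> h" "x \<notin> h" using assms(4) False by blast
  define S where "S = Pow {h \<in> R. x \<notin> h}"
  have "finite S" unfolding S_def using assms(1) by simp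
  moreover have "{h} \<in> S" unfolding S_def using h by simp
  ultimately obtain W where W: "{h} \<subseteq> W" "W \<in> S" "conn W"
    "\<And>Q. Q \<in> S \<Longrightarrow> conn Q \<Longrightarrow> W \<subseteq> Q \<Longrightarrow> Q = W"
    using maximal_conn[of S "{h}"] by (metis conn_single finite.emptyI finite_insert)
  have WR: "W \<subseteq> R" "x \<notin> \<Union>W" using W(2) unfolding S_def by auto
  then have "W \<subset> R" using assms(3) by blast
  then obtain e where e: "e \<in> R" "e \<notin> W" "e \<inter> \<Union>W \<noteq> {}"
    using connD[OF assms(2)] conn_nonempty[OF W(3)] by metis
  have "x \<in> e"
  proof (rule ccontr)
    assume "x \<notin> e"
    then have "insert e W \<in> S" using e(1) W(2) unfolding S_def by blast
    then have "insert e W = W" using W(4) conn_insert[OF W(3) e(3)] by blast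
    then show False using e(2) by blast
  qed
  have "(e - {x}) \<inter> \<Union>W \<noteq> {}" using e(3) WR(2) by blast
  then have "conn (insert (e - {x}) W)" by (rule conn_insert[OF W(3)])
  then show ?thesis
    by (rule that[of e W, rotated 4]) (use e(1) \<open>x \<in> e\<close> WR W(1) h(2) in auto)
qed

locale aw_rank3 =
  fixes V :: "'a set" and F :: "'a set set"
  assumes aw: "aw V F" and sub: "F \<subseteq> Pow V" and lin: "linear_edges F"
    and rank: "\<And>e. e \<in> F \<Longrightarrow> card e \<le> 3"
begin

lemma finV: "finite V"
  using aw aw_finite by blast

lemma finF: "finite F"
  using finV sub finite_subset by blast

lemma fine: "e \<in> F \<Longrightarrow> finite e"
  using finV sub finite_subset by blast

lemma card_edge: "e \<in> F \<Longrightarrow> card e = 2 \<or> card e = 3"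
  using aw_edge_card[OF aw, of e] sub rank[of e] by force

lemma aw_sub: "G \<subseteq> F \<Longrightarrow> aw (\<Union>G) G"
  using aw_restrict[OF aw, of "\<Union>G" G] sub by blast

lemma aw_rank3_sub: "G \<subseteq> F \<Longrightarrow> aw_rank3 (\<Union>G) G"
  using aw_sub linear_edges_subset[OF lin] rank by unfold_locales auto

end

lemma aw_rank3_shrink:
  assumes "aw_rank3 V F" "odd (card V)"
  obtains x where "x \<in> V" "aw_rank3 (V - {x}) (shrink x F)"
proof -
  interpret aw_rank3 V F by fact
  obtain x where x: "x \<in> V" "aw (V - {x}) (shrink x F)" using aw_oddE[OF aw assms(2)] .
  have "aw_rank3 (V - {x}) (shrink x F)"
  proof
    show "linear_edges (shrink x F)" using linear_edges_shrink[OF lin fine] .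
    show "card e \<le> 3" if e: "e \<in> shrink x F" for e
    proof -
      obtain d where "d \<in> F" "e = d - {x}" using e by blast
      then have "card e \<le> card d" using fine[of d] by (simp add: card_mono)
      then show ?thesis using rank[OF \<open>d \<in> F\<close>] by linarith
    qed
  qed (use x sub in auto)
  then show ?thesis using that x by blast
qed

text \<open>Infinite descent: in an odd family, Avoider's move leaves two connected 2-edges, and
  \<open>two_2_edges\<close> extracts from them an odd connected subfamily containing
  \<open>u\<close> on fewer vertices. That subfamily lives in the shrunk position, so
  \<open>V\<close> and \<open>F\<close> vary in the induction.\<close>

lemma aw_conn_2_edge_even:
  assumes "aw_rank3 V F" "G \<subseteq> F" "conn G" "u \<in> G" "card u = 2"
  shows "even (card (\<Union>G))"
  using assms
proof (induction "card (\<Union>G)" arbitrary: V F G rule: less_induct)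
  case less
  note GF = less.prems(2) and cG = less.prems(3) and u = less.prems(4,5)
  show ?case
  proof (rule ccontr)
    assume odd: "odd (card (\<Union>G))"
    interpret G: aw_rank3 "\<Union>G" G using aw_rank3.aw_rank3_sub[OF less.prems(1,2)] .
    obtain x where x: "x \<in> \<Union>G" "aw_rank3 (\<Union>G - {x}) (shrink x G)"
      using aw_rank3_shrink[OF G.aw_rank3_axioms odd] .
    interpret S: aw_rank3 "\<Union>G - {x}" "shrink x G" by (rule x(2))
    have "x \<notin> u"
    proof
      assume "x \<in> u"
      then have "card (u - {x}) = 1" using u G.fine by simp
      moreover have "u - {x} \<in> shrink x G" using u(1) by (rule imageI)
      ultimately show False using S.card_edge[of "u - {x}"] by linarith
    qed
    have "u \<noteq> {}" using u by auto
    then obtain p where p: "p \<in> u" by blast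
    have "p \<in> \<Union>G" "p \<noteq> x" using p u \<open>x \<notin> u\<close> by auto
    then obtain e W where e: "e \<in> G" "x \<in> e" "W \<subseteq> G" "\<And>h. h \<in> W \<Longrightarrow> x \<notin> h"
      "conn (insert (e - {x}) W)" "p \<in> \<Union>(insert (e - {x}) W)"
      using conn_shrink_reach[OF G.finF cG x(1)] by metis
    define K where "K = insert u (insert (e - {x}) W)"
    have cK: "conn K" unfolding K_def by (rule conn_insert[OF e(5)]) (use p e(6) in blast)
    have KS: "K \<subseteq> shrink x G"
      unfolding K_def using shrink_id[OF e(3,4)] shrink_id[of "{u}" G x] u \<open>x \<notin> u\<close> e(1) by auto
    have "card e \<noteq> 2"
    proof
      assume "card e = 2"
      then have "card (e - {x}) = 1" using e G.fine by simp
      moreover have "e - {x} \<in> shrink x G" using e(1) by (rule imageI)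
      ultimately show False using S.card_edge[of "e - {x}"] by linarith
    qed
    then have "card e = 3" using G.card_edge e by blast
    then have e2: "card (e - {x}) = 2" using e G.fine by simp
    \<comment> \<open>Otherwise \<open>e\<close> would contain both vertices of \<open>u\<close>,
      against linearity.\<close>
    have "e - {x} \<noteq> u"
    proof
      assume "e - {x} = u"
      then have "e \<inter> u = u" by blast
      moreover have "card (e \<inter> u) \<le> 1" using linear_edgesD[OF G.lin e(1) u(1)] e(2) \<open>x \<notin> u\<close> by blast
      ultimately show False using u by simp
    qed
    obtain H where H: "H \<subseteq> K" "conn H" "u \<in> H" "odd (card (\<Union>H))"
    proof (rule two_2_edges[of K u "e - {x}"])
      show "finite K" using S.finF KS finite_subset by blast
      show "linear_edges K" using linear_edges_subset[OF S.lin KS] .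
      show "finite f" if "f \<in> K" for f using S.fine KS that by blast
    qed (use cK u e2 \<open>e - {x} \<noteq> u\<close> in \<open>auto simp: K_def\<close>)
    have HS: "H \<subseteq> shrink x G" using H(1) KS by blast
    have "\<Union>H \<subset> \<Union>G" using HS x(1) S.sub by blast
    then have "card (\<Union>H) < card (\<Union>G)" by (rule psubset_card_mono[OF G.finV])
    then show False using less.hyps[OF _ x(2) HS H(2,3) u(2)] H(4) by blast
  qed
qed

lemma aw_conn_2_edge_unique:
  assumes "aw_rank3 V F" "G \<subseteq> F" "conn G" "u \<in> G" "v \<in> G" "card u = 2" "card v = 2"
  shows "u = v"
proof (rule ccontr)
  assume "u \<noteq> v"
  interpret G: aw_rank3 "\<Union>G" G using aw_rank3.aw_rank3_sub[OF assms(1,2)] .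
  obtain H where "H \<subseteq> G" "conn H" "u \<in> H" "odd (card (\<Union>H))"
    using two_2_edges[OF G.finF G.lin assms(3-5) \<open>u \<noteq> v\<close> assms(6,7) G.fine] .
  then show False using aw_conn_2_edge_even[OF G.aw_rank3_axioms] assms(6) by blast
qed

lemma aw_pendant_edge:
  assumes "aw_rank3 V F" "G \<subseteq> F" "conn G" "u \<in> G" "card u = 2" "g \<in> G" "g \<noteq> u" "conn (G - {g})"
  shows "card (g - \<Union>(G - {g})) \<ge> 2"
proof -
  interpret G: aw_rank3 "\<Union>G" G using aw_rank3.aw_rank3_sub[OF assms(1,2)] .
  have three: "card e = 3" if e: "e \<in> G - {u}" for e
  proof (rule ccontr)
    assume "card e \<noteq> 3"
    then have "card e = 2" using G.card_edge[of e] e by blast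
    then have "u = e" using aw_conn_2_edge_unique[OF assms(1-4) _ assms(5)] e by blast
    then show False using e by blast
  qed
  have even: "even (card (\<Union>H))" if "H \<subseteq> G" "conn H" "u \<in> H" for H
    by (rule aw_conn_2_edge_even[OF G.aw_rank3_axioms that assms(5)])
  show ?thesis
    by (rule pendant_edge[OF G.finF G.lin assms(3-5)]) (use three even assms(6-8) in blast)+
qed

text \<open>Avoider's move \<open>x\<close> turns each edge through \<open>x\<close> into a 2-edge,
  and \<open>aw_conn_2_edge_unique\<close> forbids two of these in one connected part of the shrunk
  family. The count is proved for every connected subfamily covering \<open>x\<close>, a class
  preserved when suitable edges are removed.\<close>

lemma aw_conn_odd_tree:
  assumes "aw_rank3 V F" "G \<subseteq> F" "conn G" "\<And>e. e \<in> G \<Longrightarrow> card e = 3" "odd (card (\<Union>G))"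
  shows "card (\<Union>G) = 2 * card G + 1"
proof -
  interpret G: aw_rank3 "\<Union>G" G using aw_rank3.aw_rank3_sub[OF assms(1,2)] .
  obtain x where x: "x \<in> \<Union>G" "aw_rank3 (\<Union>G - {x}) (shrink x G)"
    using aw_rank3_shrink[OF G.aw_rank3_axioms assms(5)] .
  interpret S: aw_rank3 "\<Union>G - {x}" "shrink x G" by (rule x(2))
  have two: "card (e - {x}) = 2" "e - {x} \<in> shrink x G" if "e \<in> G" "x \<in> e" for e
    using that assms(4)[OF that(1)] G.fine by auto
  have unique: "e = f" if "K \<subseteq> shrink x G" "conn K" "e - {x} \<in> K" "f - {x} \<in> K" "e \<in> G" "f \<in> G" "x \<in> e" "x \<in> f" for K e f
    using aw_conn_2_edge_unique[OF x(2) that(1-4)] two that by (metis insert_Diff)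
  have "card (\<Union>H) = 2 * card H + 1" if "H \<subseteq> G" "conn H" "x \<in> \<Union>H" for H
    using that
  proof (induction "card H" arbitrary: H rule: less_induct)
    case less
    have finH: "finite H" using less.prems(1) G.finF finite_subset by blast
    have finU: "finite (\<Union>H)" by (rule finite_subset[OF Union_mono[OF less.prems(1)] G.finV])
    obtain e where e: "e \<in> H" "x \<in> e" using less.prems by blast
    show ?case
    proof (cases "H = {e}")
      case True
      then show ?thesis using assms(4)[of e] less.prems by simp
    next
      case False
      then have "{e} \<subset> H" using e by blast
      \<comment> \<open>Retaining \<open>e\<close> keeps \<open>x\<close> covered, as the induction
        hypothesis requires.\<close>
      then obtain g where g: "g \<in> H" "g \<notin> {e}" "conn (H - {g})" "{e} \<subseteq> H - {g}"
        using conn_removable[OF finH less.prems(2) conn_single] by metis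
      define R where "R = H - {g}"
      have R: "conn R" "R \<subseteq> G" "g \<notin> R" "x \<in> \<Union>R" "finite R"
        using g e less.prems(1) finH unfolding R_def by auto
      have gG: "g \<in> G" "card g = 3" using g less.prems assms(4) by auto
      have IH: "card (\<Union>R) = 2 * card R + 1"
      proof (rule less.hyps[OF _ R(2) R(1) R(4)])
        show "card R < card H" unfolding R_def using finH g by (metis card_Diff1_less)
      qed
      \<comment> \<open>The edge \<open>g\<close> must attach to \<open>R\<close> at a single
        vertex. Of two attachment vertices at least one differs from \<open>x\<close> and can be
        called \<open>q\<close>; \<open>p\<close> may be \<open>x\<close> itself.\<close>
      have two_not: False if pq: "p \<in> g" "q \<in> g" "p \<noteq> q" "p \<in> \<Union>R" "q \<in> \<Union>R" "q \<noteq> x" for p q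
      proof -
        obtain eq Wq where q: "eq \<in> R" "x \<in> eq" "Wq \<subseteq> R" "\<And>h. h \<in> Wq \<Longrightarrow> x \<notin> h"
          "conn (insert (eq - {x}) Wq)" "q \<in> \<Union>(insert (eq - {x}) Wq)"
          using conn_shrink_reach[OF R(5) R(1) R(4) pq(5,6)] by metis
        have KqS: "insert (eq - {x}) Wq \<subseteq> shrink x G"
          using shrink_id[of Wq G x] q R(2) by auto
        have eqG: "eq \<in> G" "eq \<noteq> g" using q R by auto
        show False
        proof (cases "x \<in> g")
          case True
          \<comment> \<open>Here \<open>g - {x}\<close> and \<open>eq - {x}\<close> are 2-edges
            connected through \<open>q\<close>.\<close>
          define K where "K = insert (g - {x}) (insert (eq - {x}) Wq)"
          have "conn K" unfolding K_def by (rule conn_insert[OF q(5)]) (use pq(2,6) q(6) in blast)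
          moreover have "K \<subseteq> shrink x G" unfolding K_def using KqS gG by blast
          ultimately have "g = eq" using unique[of K g eq] gG eqG True q(2) unfolding K_def by blast
          then show False using eqG by blast
        next
          case False
          then have "p \<noteq> x" using pq by blast
          then obtain ep Wp where p: "ep \<in> R" "x \<in> ep" "Wp \<subseteq> R" "\<And>h. h \<in> Wp \<Longrightarrow> x \<notin> h"
            "conn (insert (ep - {x}) Wp)" "p \<in> \<Union>(insert (ep - {x}) Wp)"
            using conn_shrink_reach[OF R(5) R(1) R(4) pq(4)] by metis
          have KpS: "insert (ep - {x}) Wp \<subseteq> shrink x G"
            using shrink_id[of Wp G x] p R(2) by auto
          have epG: "ep \<in> G" using p R by auto
          have gS: "g \<in> shrink x G" using shrink_id[of "{g}" G x] gG False by blast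
          define Kq where "Kq = insert g (insert (eq - {x}) Wq)"
          have cKq: "conn Kq" unfolding Kq_def by (rule conn_insert[OF q(5)]) (use pq(2) q(6) in blast)
          define K where "K = insert (ep - {x}) Wp \<union> Kq"
          have cK: "conn K" unfolding K_def
            by (rule conn_Un[OF p(5) cKq]) (use p(6) pq(1) in \<open>auto simp: Kq_def\<close>)
          have KS: "K \<subseteq> shrink x G" unfolding K_def Kq_def using KqS KpS gS by blast
          \<comment> \<open>Joined by \<open>g\<close>, the routes from \<open>p\<close> and
            \<open>q\<close> lie in one connected shrunk family, so they arrive at \<open>x\<close>
            through the same edge and form a connected family even without \<open>g\<close>.\<close>
          have epq: "ep = eq" using unique[OF KS cK, of ep eq] epG eqG p(2) q(2) unfolding K_def Kq_def by blast
          define K0 where "K0 = insert (ep - {x}) Wp \<union> insert (eq - {x}) Wq"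
          have "ep - {x} \<noteq> {}" using two(1)[OF epG p(2)] by (metis card.empty zero_neq_numeral)
          then have cK0: "conn K0" unfolding K0_def
            by (intro conn_Un[OF p(5) q(5)]) (use epq in auto)
          have gne: "g \<noteq> ep - {x}" "g \<notin> Wp" "g \<notin> Wq"
            using two(1)[OF epG p(2)] gG R(3) p(3) q(3) by auto
          then have Kg: "K - {g} = K0" "g \<in> K" unfolding K_def K0_def Kq_def using epq by auto
          have "2 \<le> card (g - \<Union>(K - {g}))"
          proof (rule aw_pendant_edge[OF x(2) KS cK])
            show "ep - {x} \<in> K" unfolding K_def by blast
            show "card (ep - {x}) = 2" using two[OF epG p(2)] by blast
            show "g \<noteq> ep - {x}" by fact
          qed (use Kg cK0 in auto)
          moreover have "card (g - \<Union>(K - {g})) \<le> card (g - {p, q})"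
          proof (rule card_mono)
            show "finite (g - {p, q})" using G.fine[OF gG(1)] by simp
            have "p \<in> \<Union>K0" "q \<in> \<Union>K0" unfolding K0_def using p(6) q(6) by blast+
            then show "g - \<Union>(K - {g}) \<subseteq> g - {p, q}" unfolding Kg(1) by blast
          qed
          moreover have "card (g - {p, q}) = 1" using gG pq G.fine by (simp add: card_Diff_subset)
          ultimately show False by linarith
        qed
      qed
      have "card (g \<inter> \<Union>R) \<le> 1"
      proof (rule ccontr)
        assume "\<not> card (g \<inter> \<Union>R) \<le> 1"
        then have "2 \<le> card (g \<inter> \<Union>R)" by linarith
        then obtain T where "T \<subseteq> g \<inter> \<Union>R" "card T = 2" by (meson obtain_subset_with_card_n)
        then obtain p q where pq: "p \<noteq> q" "p \<in> g" "q \<in> g" "p \<in> \<Union>R" "q \<in> \<Union>R"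
          by (auto simp: card_2_iff)
        then show False using two_not[of p q] two_not[of q p] by metis
      qed
      moreover have "card (g \<inter> \<Union>R) + card (g - \<Union>R) = 3"
        using G.fine gG by (metis Int_commute card_Diff_subset_Int card_Int_Diff finite_Int)
      moreover have "card (g - \<Union>R) < 3"
        using private_less[OF less.prems(2) g(1)] conn_nonempty R(1) G.fine gG unfolding R_def by metis
      moreover have "card (\<Union>H) = card (\<Union>R) + card (g - \<Union>R)"
        unfolding R_def using card_Union_remove[OF finU g(1)] .
      moreover have "card H = Suc (card R)" unfolding R_def using card.remove[OF finH g(1)] .
      ultimately show ?thesis using IH by linarith
    qed
  qed
  then show ?thesis using assms(3) x(1) by blast
qed

section \<open>Families without leaf-edges\<close>

abbreviation hg :: "'a set set \<Rightarrow> 'a hypergraph" where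
  "hg F \<equiv> \<lparr>verts = \<Union>F, edges = F\<rparr>"

lemma walk_Cons: "walk H (e # es) \<longleftrightarrow> e \<in> edges H \<and> (es = [] \<or> walk H es \<and> e \<inter> hd es \<noteq> {})"
proof (cases es)
  case Nil
  then show ?thesis by (simp add: walk_def)
next
  case (Cons f fs)
  then show ?thesis
    by (auto simp: walk_def nth_Cons split: nat.splits)
qed

lemma walk_single [simp]: "walk H [e] \<longleftrightarrow> e \<in> edges H"
  by (simp add: walk_Cons)

lemma walk_append:
  assumes "walk H xs" "walk H ys" "last xs \<inter> hd ys \<noteq> {}"
  shows "walk H (xs @ ys)"
  using assms
proof (induction xs)
  case Nil
  then show ?case by simp
next
  case (Cons x xs)
  have "ys \<noteq> []" using Cons.prems(2) by (simp add: walk_def)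
  show ?case
  proof (cases "xs = []")
    case True
    then show ?thesis using Cons.prems \<open>ys \<noteq> []\<close> by (simp add: walk_Cons)
  next
    case False
    then show ?thesis using Cons by (simp add: walk_Cons)
  qed
qed

lemma walk_drop: "walk H es \<Longrightarrow> i < length es \<Longrightarrow> walk H (drop i es)"
  by (auto simp: walk_def dest: in_set_dropD)

lemma walk_take: "walk H es \<Longrightarrow> 0 < i \<Longrightarrow> walk H (take i es)"
  by (auto simp: walk_def dest: in_set_takeD)

lemma conn_walk: "walk H es \<Longrightarrow> conn (set es)"
proof (induction es)
  case Nil
  then show ?case by (simp add: walk_def)
next
  case (Cons e es)
  show ?case
  proof (cases "es = []")
    case True
    then show ?thesis by simp
  next
    case False
    then have "walk H es" "e \<inter> hd es \<noteq> {}" using Cons.prems by (auto simp: walk_Cons)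
    moreover have "e \<inter> \<Union>(set es) \<noteq> {}"
      using \<open>e \<inter> hd es \<noteq> {}\<close> hd_in_set[OF False] by blast
    ultimately show ?thesis using Cons.IH conn_insert[of "set es" e] by simp
  qed
qed

lemma conn_obtains_walk:
  assumes "conn T" "T \<subseteq> edges H" "a \<in> \<Union>T" "b \<in> \<Union>T"
  obtains es where "walk H es" "set es \<subseteq> T" "a \<in> hd es" "b \<in> last es"
proof -
  define S where "S = {e \<in> T. \<exists>es. walk H es \<and> set es \<subseteq> T \<and> hd es = e \<and> b \<in> last es}"
  obtain f where f: "f \<in> T" "b \<in> f" using assms(4) by blast
  have "f \<in> S" unfolding S_def using f assms(2) by (auto intro!: exI[of _ "[f]"])
  have "S = T"
  proof (rule ccontr)
    assume "S \<noteq> T"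
    then have "S \<subset> T" unfolding S_def by blast
    then obtain e where e: "e \<in> T" "e \<notin> S" "e \<inter> \<Union>S \<noteq> {}"
      using connD[OF assms(1), of S] \<open>f \<in> S\<close> by (metis empty_iff)
    then obtain f where "f \<in> S" "e \<inter> f \<noteq> {}" by blast
    then obtain es where es: "walk H es" "set es \<subseteq> T" "e \<inter> hd es \<noteq> {}" "b \<in> last es"
      unfolding S_def by blast
    have "es \<noteq> []" using es(1) by (simp add: walk_def)
    have "walk H (e # es)" using es e(1) assms(2) by (auto simp: walk_Cons)
    then have "e \<in> S" unfolding S_def using e(1) es \<open>es \<noteq> []\<close> by (auto intro!: exI[of _ "e # es"])
    then show False using e(2) by blast
  qed
  obtain e where "e \<in> T" "a \<in> e" using assms(3) by blast
  then show ?thesis using that \<open>S = T\<close> unfolding S_def by blast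
qed

lemma shortest_walk:
  assumes "conn T" "p \<in> \<Union>T" "q \<in> \<Union>T"
  obtains es where "walk (hg T) es" "simple_walk (hg T) es" "distinct es" "p \<in> hd es" "q \<in> last es"
    "\<And>e. e \<in> set es \<Longrightarrow> p \<in> e \<Longrightarrow> e = hd es" "\<And>e. e \<in> set es \<Longrightarrow> q \<in> e \<Longrightarrow> e = last es"
proof -
  define good where "good es \<longleftrightarrow> walk (hg T) es \<and> p \<in> hd es \<and> q \<in> last es" for es
  have "\<exists>es. good es" 
    unfolding good_def by (rule conn_obtains_walk[OF assms(1) _ assms(2,3), of "hg T"]) auto
  then obtain es where es: "good es" "\<And>fs. good fs \<Longrightarrow> length es \<le> length fs"
    using ex_has_least_nat[of good _ length] by blast
  have w: "walk (hg T) es" "p \<in> hd es" "q \<in> last es" using es(1) good_def by auto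
  have ne: "es \<noteq> []" using w by (simp add: walk_def)
  have simple: "es ! i \<inter> es ! j = {}" if ij: "j < length es" "i + 2 \<le> j" for i j
  proof (rule ccontr)
    assume meet: "es ! i \<inter> es ! j \<noteq> {}"
    define fs where "fs = take (Suc i) es @ drop j es"
    have "last (take (Suc i) es) = es ! i" using ij by (simp add: take_Suc_conv_app_nth)
    moreover have "hd (drop j es) = es ! j" using ij by (simp add: hd_drop_conv_nth)
    ultimately have "walk (hg T) fs" unfolding fs_def
      by (intro walk_append walk_take walk_drop w) (use meet ij in auto)
    moreover have "hd fs = hd es" unfolding fs_def using ne by (simp add: hd_append)
    moreover have "last fs = last es" unfolding fs_def using ij by simp
    ultimately have "good fs" using w good_def by simp
    then show False using es(2)[of fs] ij unfolding fs_def by simp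
  qed
  have p0: "i = 0" if i: "i < length es" "p \<in> es ! i" for i
  proof (rule ccontr)
    assume "i \<noteq> 0"
    have "good (drop i es)" using walk_drop[OF w(1) i(1)] i w by (simp add: good_def hd_drop_conv_nth)
    then show False using es(2) i \<open>i \<noteq> 0\<close> by fastforce
  qed
  have ql: "i = length es - 1" if i: "i < length es" "q \<in> es ! i" for i
  proof (rule ccontr)
    assume "i \<noteq> length es - 1"
    have "good (take (Suc i) es)"
      using walk_take[OF w(1), of "Suc i"] i w ne by (simp add: good_def take_Suc_conv_app_nth hd_append hd_conv_nth)
    then show False using es(2)[of "take (Suc i) es"] i \<open>i \<noteq> length es - 1\<close> by simp
  qed
  have neq: "es ! i \<noteq> es ! j" if ij: "i < j" "j < length es" for i j
  proof
    assume eq: "es ! i = es ! j"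
    show False
    proof (cases i)
      case 0
      then have "p \<in> es ! j" using eq w ne by (simp add: hd_conv_nth)
      then show False using p0 ij by blast
    next
      case (Suc k)
      have "es ! k \<inter> es ! Suc k \<noteq> {}" using w(1) ij Suc unfolding walk_def by auto
      moreover have "es ! k \<inter> es ! j = {}" using simple[of j k] ij Suc by simp
      ultimately show False using eq Suc by simp
    qed
  qed
  have "distinct es" unfolding distinct_conv_nth using neq by (metis linorder_neqE_nat)
  show ?thesis
  proof (rule that[OF w(1) _ \<open>distinct es\<close> w(2,3)])
    show "simple_walk (hg T) es" unfolding simple_walk_def using w(1) simple by blast
    show "e = hd es" if "e \<in> set es" "p \<in> e" for e
      using that p0 ne by (metis hd_conv_nth in_set_conv_nth)
    show "e = last es" if "e \<in> set es" "q \<in> e" for e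
      using that ql ne by (metis last_conv_nth in_set_conv_nth)
  qed
qed

lemma set_minus_nth:
  assumes "distinct es" "i < length es"
  shows "set es - {es ! i} = set (take i es) \<union> set (drop (Suc i) es)"
proof -
  have eq: "es = take i es @ es ! i # drop (Suc i) es" using assms(2) by (rule id_take_nth_drop)
  have "distinct (take i es @ es ! i # drop (Suc i) es)" using assms(1) eq by simp
  then have "es ! i \<notin> set (take i es)" "es ! i \<notin> set (drop (Suc i) es)" by auto
  moreover have "set es = insert (es ! i) (set (take i es) \<union> set (drop (Suc i) es))"
    by (subst eq) auto
  ultimately show ?thesis by blast
qed

lemma minimal_conn_cycle:
  assumes T: "finite T" "conn T" "linear_edges T" "\<forall>e\<in>T. card e = 3"
    and pq: "p \<in> \<Union>T" "q \<in> \<Union>T" "p \<noteq> q" "z \<notin> \<Union>T" "\<forall>e\<in>T. \<not> (p \<in> e \<and> q \<in> e)"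
    and min: "\<forall>P. P \<subset> T \<longrightarrow> conn P \<longrightarrow> p \<in> \<Union>P \<longrightarrow> q \<notin> \<Union>P"
  shows "is_cycle (hg (insert {p, q, z} T))" "card T \<ge> 2"
    "\<And>e. e \<in> insert {p, q, z} T \<Longrightarrow> conn (insert {p, q, z} T - {e})"
proof -
  obtain es where es: "walk (hg T) es" "simple_walk (hg T) es" "distinct es" "p \<in> hd es" "q \<in> last es"
    "\<And>e. e \<in> set es \<Longrightarrow> p \<in> e \<Longrightarrow> e = hd es" "\<And>e. e \<in> set es \<Longrightarrow> q \<in> e \<Longrightarrow> e = last es"
    using shortest_walk[OF T(2) pq(1,2)] by metis
  have ne: "es \<noteq> []" "set es \<subseteq> T" using es(1) by (auto simp: walk_def)
  have "p \<in> \<Union>(set es)" "q \<in> \<Union>(set es)" using ne(1) es(4,5) hd_in_set last_in_set by blast+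
  then have set_es: "set es = T" using min conn_walk[OF es(1)] ne(2) by blast
  have "length es \<noteq> 1"
  proof
    assume "length es = 1"
    then obtain e where "es = [e]" by (cases es) auto
    then show False using es(4,5) set_es pq(5) by auto
  qed
  then have len: "2 \<le> length es" using ne by (cases es) (auto simp: Suc_le_eq)
  then show "card T \<ge> 2" using distinct_card[OF es(3)] set_es by simp
  have "hd es \<in> T" "last es \<in> T" using ne hd_in_set last_in_set by blast+
  then have ends: "e \<in> T \<and> p \<in> e \<longleftrightarrow> e = hd es" "e \<in> T \<and> q \<in> e \<longleftrightarrow> e = last es" for e
    using es(4-7) unfolding set_es by metis+
  have "chain_between p q (length es) (hg T)"
    unfolding chain_between_def
  proof (intro conjI exI[of _ es])
    show "linear_walk (hg T) es" unfolding linear_walk_def using es set_es T(3) by simp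
    show "{e \<in> edges (hg T). p \<in> e} = {hd es}" by (simp add: ends)
    show "{e \<in> edges (hg T). q \<in> e} = {last es}" by (simp add: ends)
  qed (use es(2) set_es T(4) pq(3) in simp_all)
  moreover have "hg (insert {p, q, z} T)
    = \<lparr>verts = insert z (verts (hg T)), edges = insert {p, q, z} (edges (hg T))\<rparr>"
    using pq by auto
  ultimately show "is_cycle (hg (insert {p, q, z} T))"
    unfolding is_cycle_def using len pq(4) by (metis select_convs(1))
  fix e assume e: "e \<in> insert {p, q, z} T"
  have gT: "{p, q, z} \<notin> T" using pq(4) by blast
  show "conn (insert {p, q, z} T - {e})"
  proof (cases "e = {p, q, z}")
    case True
    then have "insert {p, q, z} T - {e} = T" using gT by blast
    then show ?thesis using T(2) by simp
  next
    case False
    then obtain i where i: "i < length es" "e = es ! i" using e set_es by (metis in_set_conv_nth insertE)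
    define A where "A = insert {p, q, z} (set (take i es))"
    define B where "B = insert {p, q, z} (set (drop (Suc i) es))"
    have "conn A"
    proof (cases "i = 0")
      case True
      then show ?thesis unfolding A_def by simp
    next
      case False
      then have "conn (set (take i es))" using conn_walk[OF walk_take[OF es(1)]] by blast
      moreover have "hd es \<in> set (take i es)" using False ne hd_in_set[of "take i es"] by (cases es) auto
      ultimately show ?thesis unfolding A_def using es(4) by (intro conn_insert) auto
    qed
    moreover have "conn B"
    proof (cases "Suc i < length es")
      case False
      then show ?thesis unfolding B_def by simp
    next
      case True
      then have "conn (set (drop (Suc i) es))" using conn_walk[OF walk_drop[OF es(1)]] by blast
      moreover have "last es \<in> set (drop (Suc i) es)" using True last_in_set[of "drop (Suc i) es"] by simp
      ultimately show ?thesis unfolding B_def using es(5) by (intro conn_insert) auto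
    qed
    ultimately have "conn (A \<union> B)" by (rule conn_Un) (auto simp: A_def B_def)
    moreover have "A \<union> B = insert {p, q, z} T - {e}"
      using set_minus_nth[OF es(3) i(1)] i(2) set_es False unfolding A_def B_def by auto
    ultimately show ?thesis by simp
  qed
qed

lemma conn_remove_leaf:
  assumes "conn R" "h \<in> R" "R - {h} \<noteq> {}" "finite h" "card (h \<inter> \<Union>(R - {h})) \<le> 1"
  shows "conn (R - {h})"
  unfolding conn_def
proof (intro conjI allI impI)
  fix P assume P: "P \<subset> R - {h} \<and> P \<noteq> {}"
  then have "P \<subset> R" "P \<noteq> {}" by auto
  then obtain e where e: "e \<in> R" "e \<notin> P" "e \<inter> \<Union>P \<noteq> {}" using connD[OF assms(1)] by metis
  show "\<exists>e\<in>R - {h} - P. e \<inter> \<Union>P \<noteq> {}"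
  proof (cases "e = h")
    case False
    then show ?thesis using e by blast
  next
    case True
    then obtain w where w: "w \<in> h" "w \<in> \<Union>P" using e by blast
    then have wR: "w \<in> h \<inter> \<Union>(R - {h})" using P by blast
    have "insert h P \<subset> R" using P assms(2) by blast
    then obtain f where f: "f \<in> R" "f \<notin> insert h P" "f \<inter> \<Union>(insert h P) \<noteq> {}"
      using connD[OF assms(1)] by (metis insert_not_empty)
    then obtain y where y: "y \<in> f" "y \<in> h \<or> y \<in> \<Union>P" by blast
    have "y \<in> \<Union>P"
    proof (cases "y \<in> h")
      case True
      then have "y \<in> h \<inter> \<Union>(R - {h})" using f y by blast
      then have "y = w"
        using wR assms(4,5) card_le_Suc0_iff_eq[of "h \<inter> \<Union>(R - {h})"] by (metis One_nat_def finite_Int)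
      then show ?thesis using w by blast
    qed (use y in blast)
    then show ?thesis using f y by blast
  qed
qed (use assms in blast)

text \<open>For a 3-edge, being a leaf-edge means that at least two of its vertices lie in no other
  edge.\<close>

definition no_leaf :: "'a set set \<Rightarrow> bool" where
  "no_leaf F \<longleftrightarrow> (\<forall>g\<in>F. card (g - \<Union>(F - {g})) \<le> 1)"

definition cyclic :: "'a set set \<Rightarrow> bool" where
  "cyclic F \<longleftrightarrow> conn F \<and> card (\<Union>F) = 2 * card F \<and> 3 \<le> card F \<and> no_leaf F \<and>
     (\<forall>e\<in>F. conn (F - {e})) \<and> is_cycle (hg F)"

definition odd_trees :: "'a set set \<Rightarrow> bool" where
  "odd_trees F \<longleftrightarrow> (\<forall>G\<subseteq>F. conn G \<and> odd (card (\<Union>G)) \<longrightarrow> card (\<Union>G) = 2 * card G + 1)"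

lemma odd_treesD: "odd_trees F \<Longrightarrow> G \<subseteq> F \<Longrightarrow> conn G \<Longrightarrow> odd (card (\<Union>G)) \<Longrightarrow> card (\<Union>G) = 2 * card G + 1"
  by (simp add: odd_trees_def)

lemma odd_trees_subset: "odd_trees F \<Longrightarrow> G \<subseteq> F \<Longrightarrow> odd_trees G"
  unfolding odd_trees_def by (meson order_trans)

definition degree_one :: "'a set set \<Rightarrow> 'a set" where
  "degree_one F = {v \<in> \<Union>F. card {e \<in> F. v \<in> e} = 1}"

lemma degree_one_eq: "degree_one F = (\<Union>e\<in>F. e - \<Union>(F - {e}))"
proof (intro equalityI subsetI)
  fix v assume "v \<in> degree_one F"
  then have "card {e \<in> F. v \<in> e} = 1" by (simp add: degree_one_def)
  then obtain e where e: "{e \<in> F. v \<in> e} = {e}" using card_1_singletonE by metis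
  then have "e \<in> F" "v \<in> e - \<Union>(F - {e})" by auto
  then show "v \<in> (\<Union>e\<in>F. e - \<Union>(F - {e}))" by blast
next
  fix v assume "v \<in> (\<Union>e\<in>F. e - \<Union>(F - {e}))"
  then obtain e where e: "e \<in> F" "v \<in> e" "v \<notin> \<Union>(F - {e})" by blast
  then have "{e \<in> F. v \<in> e} = {e}" by auto
  then show "v \<in> degree_one F" using e by (auto simp: degree_one_def)
qed

lemma cyclic_chord:
  assumes T: "cyclic T" "finite T" "\<And>e. e \<in> T \<Longrightarrow> card e = 3"
    and g: "card g = 3" "g \<subseteq> \<Union>T" "g \<notin> T" and odd: "odd_trees (insert g T)"
  shows "card T = 3" "g = degree_one T"
proof -
  have cyc: "card (\<Union>T) = 2 * card T" "3 \<le> card T" "no_leaf T" "\<And>e. e \<in> T \<Longrightarrow> conn (T - {e})"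
    using T(1) unfolding cyclic_def by auto
  have fine: "finite e" if "e \<in> T" for e using T(3)[OF that] by (intro card_ge_0_finite) simp
  have finU: "finite (\<Union>T)" using T(2) fine by blast
  have finG: "finite g" using g(1) by (intro card_ge_0_finite) simp
  have priv: "card (e - \<Union>(T - {e})) = 1 \<and> e - \<Union>(T - {e}) \<subseteq> g" if e: "e \<in> T" for e
  proof -
    have c: "conn (T - {e})" using cyc(4) e .
    have ct: "card T = Suc (card (T - {e}))" using card.remove[OF T(2) e] .
    have "card (\<Union>(T - {e})) \<le> 2 * card (T - {e}) + 1"
      using conn_card_Union_le[OF _ c] T(2,3) by blast
    moreover have eq: "card (\<Union>T) = card (\<Union>(T - {e})) + card (e - \<Union>(T - {e}))"
      using card_Union_remove[OF finU e] .
    moreover have "card (e - \<Union>(T - {e})) \<le> 1" using cyc(3) e unfolding no_leaf_def by blast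
    ultimately have one: "card (e - \<Union>(T - {e})) = 1" and tree: "card (\<Union>(T - {e})) = 2 * card (T - {e}) + 1"
      using cyc(1) ct by linarith+
    have "g \<inter> (e - \<Union>(T - {e})) \<noteq> {}"
    proof
      assume "g \<inter> (e - \<Union>(T - {e})) = {}"
      then have gT: "g \<subseteq> \<Union>(T - {e})" using g(2) by blast
      have "g \<noteq> {}" using g(1) by auto
      then have "conn (insert g (T - {e}))" using gT by (intro conn_insert[OF c]) blast
      moreover have U: "\<Union>(insert g (T - {e})) = \<Union>(T - {e})" using gT by blast
      ultimately have "card (\<Union>(insert g (T - {e}))) = 2 * card (insert g (T - {e})) + 1"
        using odd_treesD[OF odd, of "insert g (T - {e})"] tree by auto
      then show False using U tree g(3) T(2) by simp
    qed
    then show ?thesis using one by (metis card_1_singletonE disjoint_iff empty_subsetI insert_subset singletonD)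
  qed
  have "card (degree_one T) = (\<Sum>e\<in>T. card (e - \<Union>(T - {e})))"
    unfolding degree_one_eq by (rule card_UN_disjoint) (use T(2) fine in auto)
  also have "\<dots> = card T" using priv by simp
  finally have D: "card (degree_one T) = card T" .
  have sub: "degree_one T \<subseteq> g" unfolding degree_one_eq using priv by blast
  then have "card (degree_one T) \<le> 3" using card_mono[OF finG] g(1) by metis
  then show "card T = 3" using D cyc(2) by linarith
  then show "g = degree_one T" using card_subset_eq[OF finG sub] D g(1) by simp
qed

lemma removed_edge_tree:
  assumes F: "finite F" "conn F" "\<And>e. e \<in> F \<Longrightarrow> card e = 3" "odd_trees F"
    and g: "g \<in> F" "conn (F - {g})" "card (g - \<Union>(F - {g})) = 1"
  shows "card (\<Union>(F - {g})) = 2 * card (F - {g}) + 1"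
proof -
  have fin: "finite (\<Union>F)" using F(1,3) by (metis card.infinite finite_Union zero_neq_numeral)
  have cF: "card F = Suc (card (F - {g}))" using card.remove[OF F(1) g(1)] .
  have U: "card (\<Union>F) = Suc (card (\<Union>(F - {g})))" using card_Union_remove[OF fin g(1)] g(3) by simp
  have bound: "card (\<Union>(F - {g})) \<le> 2 * card (F - {g}) + 1"
    using conn_card_Union_le[OF _ g(2)] F(1,3) by blast
  have "odd (card (\<Union>(F - {g})))"
  proof (rule ccontr)
    assume "\<not> odd (card (\<Union>(F - {g})))"
    then have "card (\<Union>F) = 2 * card F + 1" using odd_treesD[OF F(4) _ F(2)] U by simp
    then show False using U cF bound by linarith
  qed
  then show ?thesis using odd_treesD[OF F(4) _ g(2)] by blast
qed

lemma no_leaf_removable_1: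
  assumes F: "finite F" "conn F" "linear_edges F" "\<And>e. e \<in> F \<Longrightarrow> card e = 3" "odd_trees F" "no_leaf F"
    and g: "g \<in> F" "conn (F - {g})" "card (g - \<Union>(F - {g})) = 1"
  shows "cyclic F"
proof -
  define R where "R = F - {g}"
  have R: "conn R" "R \<subseteq> F" "g \<notin> R" "insert g R = F" "finite R"
    using g F(1) unfolding R_def by auto
  have fine: "finite e" if "e \<in> F" for e using F(4)[OF that] by (intro card_ge_0_finite) simp
  have finU: "finite (\<Union>F)" using F(1) fine by blast
  have cF: "card F = Suc (card R)" unfolding R_def using card.remove[OF F(1) g(1)] .
  have tree: "card (\<Union>R) = 2 * card R + 1"
    unfolding R_def by (rule removed_edge_tree[OF F(1,2,4,5) g])
  have U: "card (\<Union>F) = Suc (card (\<Union>R))"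
    unfolding R_def using card_Union_remove[OF finU g(1)] g(3) by simp
  obtain z where z: "g - \<Union>R = {z}" using g(3) card_1_singletonE unfolding R_def by blast
  have "card (g \<inter> \<Union>R) + card (g - \<Union>R) = 3"
    using fine[OF g(1)] F(4)[OF g(1)] by (metis card_Int_Diff)
  then have "card (g \<inter> \<Union>R) = 2" using g(3) unfolding R_def by simp
  then obtain p q where pq: "g \<inter> \<Union>R = {p, q}" "p \<noteq> q" by (auto simp: card_2_iff)
  have geq: "g = {p, q, z}" using z pq(1) by blast
  have pR: "p \<in> \<Union>R" "q \<in> \<Union>R" "z \<notin> \<Union>R" using z pq(1) by auto
  have both: "\<forall>e\<in>R. \<not> (p \<in> e \<and> q \<in> e)"
  proof (intro ballI notI)
    fix e assume that: "e \<in> R" "p \<in> e \<and> q \<in> e"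
    have "e = g"
      using linear_eqI[OF F(3) _ g(1), of e p q] that R(2) fine geq pq(2) by blast
    then show False using that(1) R(3) by blast
  qed
  have linR: "linear_edges R" using linear_edges_subset[OF F(3) R(2)] .
  have three: "\<forall>e\<in>R. card e = 3" using F(4) R(2) by blast
  have min: "\<forall>P. P \<subset> R \<longrightarrow> conn P \<longrightarrow> p \<in> \<Union>P \<longrightarrow> q \<notin> \<Union>P"
  proof (intro allI impI notI)
    fix P assume P: "P \<subset> R" "conn P" "p \<in> \<Union>P" "q \<in> \<Union>P"
    obtain h where h: "h \<in> R" "h \<notin> P" "conn (R - {h})" "P \<subseteq> R - {h}"
      using conn_removable[OF R(5,1) P(2,1)] by metis
    have hF: "h \<in> F" "h \<noteq> g" using h(1) R by auto
    have finUR: "finite (\<Union>R)" using finU R(2) by (meson Union_mono finite_subset)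
    have "card (\<Union>R) = card (\<Union>(R - {h})) + card (h - \<Union>(R - {h}))"
      using card_Union_remove[OF finUR h(1)] .
    moreover have "card (\<Union>(R - {h})) \<le> 2 * card (R - {h}) + 1"
      using conn_card_Union_le[OF _ h(3)] R(5) three by blast
    moreover have "card R = Suc (card (R - {h}))" using card.remove[OF R(5) h(1)] .
    ultimately have "card (h - \<Union>(R - {h})) \<ge> 2" using tree by linarith
    moreover have "h - \<Union>(R - {h}) \<subseteq> h - \<Union>(F - {h})"
    proof
      fix y assume y: "y \<in> h - \<Union>(R - {h})"
      have "y \<notin> g"
      proof
        assume "y \<in> g"
        then have "y \<in> g \<inter> \<Union>R" using y h(1) by blast
        then have "y \<in> \<Union>P" unfolding pq(1) using P(3,4) by blast
        then show False using y h(4) by blast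
      qed
      moreover have "F - {h} = insert g (R - {h})" using R(4) hF(2) by blast
      ultimately show "y \<in> h - \<Union>(F - {h})" using y by simp
    qed
    then have "card (h - \<Union>(R - {h})) \<le> card (h - \<Union>(F - {h}))"
      using fine[OF hF(1)] by (intro card_mono) auto
    moreover have "card (h - \<Union>(F - {h})) \<le> 1" using F(6) hF(1) unfolding no_leaf_def by blast
    ultimately show False by linarith
  qed
  note cyc = minimal_conn_cycle[OF R(5,1) linR three pR(1,2) pq(2) pR(3) both min]
  have "is_cycle (hg F)" "2 \<le> card R" "\<And>e. e \<in> F \<Longrightarrow> conn (F - {e})"
    using cyc(1,2) cyc(3)[unfolded geq[symmetric] R(4)] unfolding geq[symmetric] R(4) .
  then show ?thesis
    unfolding cyclic_def using F(2,6) U tree cF by simp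
qed

theorem no_leaf_cyclic_or_prism:
  assumes "finite F" "conn F" "linear_edges F" "\<And>e. e \<in> F \<Longrightarrow> card e = 3" "odd_trees F" "no_leaf F"
  shows "cyclic F \<or> (\<exists>C. cyclic C \<and> card C = 3 \<and> F = insert (degree_one C) C)"
  using assms
proof (induction "card F" arbitrary: F rule: less_induct)
  case less
  note F = less.prems
  have fine: "finite e" if "e \<in> F" for e using F(4)[OF that] by (intro card_ge_0_finite) simp
  have finU: "finite (\<Union>F)" using F(1) fine by blast
  have noleaf: "card (e - \<Union>(F - {e})) \<le> 1" if "e \<in> F" for e
    using F(6) that unfolding no_leaf_def by blast
  obtain e where e: "e \<in> F" using conn_nonempty[OF F(2)] by blast
  have "F \<noteq> {e}"
  proof
    assume "F = {e}"
    then show False using noleaf[OF e] F(4)[OF e] by simp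
  qed
  then have "{e} \<subset> F" using e by blast
  then obtain g where g: "g \<in> F" "conn (F - {g})"
    using conn_removable[OF F(1,2) conn_single] by metis
  show ?case
  proof (cases "card (g - \<Union>(F - {g})) = 1")
    case True
    then show ?thesis using no_leaf_removable_1[OF F g] by blast
  next
    case False
    then have "card (g - \<Union>(F - {g})) = 0" using noleaf[OF g(1)] by linarith
    define R where "R = F - {g}"
    have R: "conn R" "R \<subseteq> F" "g \<notin> R" "insert g R = F" "finite R"
      using g F(1) unfolding R_def by auto
    have gR: "g \<subseteq> \<Union>R" using \<open>card (g - \<Union>(F - {g})) = 0\<close> fine[OF g(1)] unfolding R_def by simp
    have UU: "\<Union>F = \<Union>R" using gR R(4) by blast
    have cF: "card F = Suc (card R)" unfolding R_def using card.remove[OF F(1) g(1)] .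
    have g3: "card g = 3" using F(4) g(1) .
    have linR: "linear_edges R" using linear_edges_subset[OF F(3) R(2)] .
    have three: "card e = 3" if "e \<in> R" for e using F(4) R(2) that by blast
    have boundR: "card (\<Union>R) \<le> 2 * card R + 1"
      using conn_card_Union_le[OF R(5,1) three] .
    have ev: "even (card (\<Union>R))"
    proof (rule ccontr)
      assume o: "odd (card (\<Union>R))"
      then have "card (\<Union>F) = 2 * card F + 1" using odd_treesD[OF F(5) _ F(2)] UU by simp
      then show False using boundR UU cF by simp
    qed
    show ?thesis
    proof (cases "no_leaf R")
      case True
      have "cyclic R \<or> (\<exists>C. cyclic C \<and> card C = 3 \<and> R = insert (degree_one C) C)"
        using less.hyps[OF _ R(5,1) linR three odd_trees_subset[OF F(5) R(2)] True] cF by simp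
      then show ?thesis
      proof (elim disjE exE conjE)
        assume c: "cyclic R"
        have "odd_trees (insert g R)" using F(5) R(4) by simp
        from cyclic_chord[OF c R(5) three g3 gR R(3) this]
        show ?thesis using c R(4) by blast
      next
        fix C assume C: "cyclic C" "card C = 3" "R = insert (degree_one C) C"
        have CR: "C \<subseteq> R" using C(3) by blast
        have "degree_one C \<subseteq> \<Union>C" unfolding degree_one_def by blast
        then have gC: "g \<subseteq> \<Union>C" using gR C(3) by blast
        have "odd_trees (insert g C)"
          by (rule odd_trees_subset[OF F(5)]) (use CR R(4) in blast)
        moreover have "finite C" using CR R(5) finite_subset by blast
        ultimately have "g = degree_one C"
          using cyclic_chord(2)[OF C(1) _ _ g3 gC] CR R(3) three by blast
        then show ?thesis using R(3) C(3) by blast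
      qed
    next
      case False
      then obtain h where h: "h \<in> R" "card (h - \<Union>(R - {h})) \<ge> 2"
        unfolding no_leaf_def by (auto simp: not_le Suc_le_eq)
      have hF: "h \<in> F" "h \<noteq> g" using h(1) R by auto
      have h3: "card h = 3" "finite h" using F(4) fine hF by auto
      have gnh: "\<not> g \<subseteq> h" using g3 h3 hF(2) card_subset_eq by metis
      have ne: "R - {h} \<noteq> {}"
      proof
        assume "R - {h} = {}"
        then have "\<Union>R \<subseteq> h" by blast
        then show False using gnh gR by blast
      qed
      have "card (h \<inter> \<Union>(R - {h})) + card (h - \<Union>(R - {h})) = 3"
        using h3 by (metis card_Int_Diff)
      then have cRh: "conn (R - {h})" using conn_remove_leaf[OF R(1) h(1) ne h3(2)] h(2) by linarith
      have gm: "g \<inter> \<Union>(R - {h}) \<noteq> {}" using gR gnh by blast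
      have "conn (insert g (R - {h}))" using conn_insert[OF cRh gm] .
      moreover have Fh: "insert g (R - {h}) = F - {h}" using R(4) hF(2) by blast
      ultimately have cFh: "conn (F - {h})" by simp
      have "h - \<Union>(F - {h}) = (h - \<Union>(R - {h})) - (g \<inter> h)" unfolding Fh[symmetric] by blast
      then have "card (h - \<Union>(F - {h})) = card ((h - \<Union>(R - {h})) - (g \<inter> h))" by simp
      moreover have "card (g \<inter> h) \<le> 1" using linear_edgesD[OF F(3) g(1) hF(1)] hF(2) by blast
      moreover have "card (h - \<Union>(R - {h})) - card (g \<inter> h) \<le> card ((h - \<Union>(R - {h})) - (g \<inter> h))"
        using h3(2) by (intro diff_card_le_card_Diff) simp
      ultimately have "card (h - \<Union>(F - {h})) = 1" using h(2) noleaf[OF hF(1)] by linarith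
      then show ?thesis using no_leaf_removable_1[OF F hF(1) cFh] by blast
    qed
  qed
qed

section \<open>Strategies and positions\<close>

lemma mover_Avoider_iff:
  assumes "last_player p H = Avoider" "n \<le> card (verts H)"
  shows "mover p n = Avoider \<longleftrightarrow> odd (card (verts H) - n)"
  using assms by (cases p) (auto simp: last_player_def mover_def split: if_splits)

lemma picked_by_snoc:
  fixes xs :: "'a list"
  shows "picked_by q p (xs @ [x]) = (if mover p (length xs) = q then insert x (picked_by q p xs) else picked_by q p xs)"
proof -
  define I where "I n = {i. i < n \<and> mover p i = q}" for n
  have img: "picked_by q p ys = (\<lambda>i. ys ! i) ` I (length ys)" for ys :: "'a list"
    unfolding picked_by_def I_def by blast
  have "I (Suc n) = (if mover p n = q then insert n (I n) else I n)" for n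
    unfolding I_def by (auto simp: less_Suc_eq)
  moreover have "(\<lambda>i. (xs @ [x]) ! i) ` I (length xs) = (\<lambda>i. xs ! i) ` I (length xs)"
    by (rule image_cong) (auto simp: nth_append I_def)
  ultimately show ?thesis unfolding img by simp
qed

lemma picked_by_subset: "picked_by q p xs \<subseteq> set xs"
  unfolding picked_by_def by auto

lemma picked_by_disjoint:
  assumes "distinct xs"
  shows "picked_by Avoider p xs \<inter> picked_by Enforcer p xs = {}"
  using assms unfolding picked_by_def by (auto simp: nth_eq_iff_index_eq)

definition position :: "player \<Rightarrow> 'a set set \<Rightarrow> 'a list \<Rightarrow> 'a set set" where
  "position p F xs =
     (\<lambda>e. e - picked_by Avoider p xs) ` {e \<in> F. e \<inter> picked_by Enforcer p xs = {}}"

lemma position_Nil [simp]: "position p F [] = F"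
  by (simp add: position_def picked_by_def)

lemma position_Avoider:
  assumes "mover p (length xs) = Avoider"
  shows "position p F (xs @ [x]) = (\<lambda>e. e - {x}) ` position p F xs"
  unfolding position_def picked_by_snoc using assms
  by (simp add: image_image) (metis Diff_insert)

lemma position_Enforcer:
  assumes "mover p (length xs) = Enforcer" "x \<notin> set xs"
  shows "position p F (xs @ [x]) = {e \<in> position p F xs. x \<notin> e}"
  using assms picked_by_subset[of Avoider p xs]
  unfolding position_def picked_by_snoc by auto

lemma follows_snoc:
  "follows_avoider_strategy p \<sigma> (xs @ [x]) \<longleftrightarrow>
     follows_avoider_strategy p \<sigma> xs \<and> (mover p (length xs) = Avoider \<longrightarrow> x = \<sigma> xs)"
  unfolding follows_avoider_strategy_def by (auto simp: nth_append less_Suc_eq)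

lemma enforcer_wins_play_position:
  assumes "distinct xs"
  shows "enforcer_wins_play p H xs \<longleftrightarrow> {} \<in> position p (edges H) xs"
  using picked_by_disjoint[OF assms, of p] unfolding enforcer_wins_play_def position_def by auto

context
  fixes H :: "'a hypergraph" and p :: player
  assumes fin: "finite (verts H)" and last: "last_player p H = Avoider"
begin

lemma card_remaining:
  "partial_play H xs \<Longrightarrow> card (verts H - set xs) = card (verts H) - length xs"
  unfolding partial_play_def by (simp add: card_Diff_subset distinct_card)

lemma mover_remaining:
  assumes "partial_play H xs"
  shows "mover p (length xs) = Avoider \<longleftrightarrow> odd (card (verts H - set xs))"
proof -
  have "length xs \<le> card (verts H)"
    using assms card_mono[OF fin, of "set xs"] unfolding partial_play_def by (simp add: distinct_card)
  then show ?thesis using mover_Avoider_iff[OF last] card_remaining[OF assms] by simp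
qed

lemma aw_step_Enforcer:
  assumes "partial_play H xs" "aw (verts H - set xs) (position p (edges H) xs)"
    "mover p (length xs) \<noteq> Avoider" "x \<in> verts H - set xs"
  shows "aw (verts H - set (xs @ [x])) (position p (edges H) (xs @ [x]))"
proof -
  have m: "mover p (length xs) = Enforcer" using assms(3) by (cases "mover p (length xs)") auto
  have "aw (verts H - set xs - {x}) {e \<in> position p (edges H) xs. x \<notin> e}"
    using aw_evenD[OF assms(2) _ assms(4)] mover_remaining[OF assms(1)] assms(3) by blast
  moreover have "verts H - set xs - {x} = verts H - set (xs @ [x])" by auto
  ultimately show ?thesis using position_Enforcer[OF m] assms(4) by simp
qed

lemma aw_avoider_wins:
  assumes aw: "aw (verts H) (edges H)"
  shows "avoider_wins p H"
proof -
  define P where "P xs \<longleftrightarrow> aw (verts H - set xs) (position p (edges H) xs)" for xs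
  define \<sigma> where "\<sigma> xs = (SOME x. x \<in> verts H - set xs \<and> (P xs \<longrightarrow> P (xs @ [x])))" for xs
  have \<sigma>: "\<sigma> xs \<in> verts H - set xs \<and> (P xs \<longrightarrow> P (xs @ [\<sigma> xs]))"
    if xs: "partial_play H xs" "\<not> complete_play H xs" "mover p (length xs) = Avoider" for xs
  proof -
    have "\<exists>x. x \<in> verts H - set xs \<and> (P xs \<longrightarrow> P (xs @ [x]))"
    proof (cases "P xs")
      case True
      then obtain x where x: "x \<in> verts H - set xs"
        "aw (verts H - set xs - {x}) ((\<lambda>e. e - {x}) ` position p (edges H) xs)"
        using aw_oddE mover_remaining[OF xs(1)] xs(3) unfolding P_def by metis
      moreover have "verts H - set xs - {x} = verts H - set (xs @ [x])" by auto
      ultimately have "P (xs @ [x])" unfolding P_def position_Avoider[OF xs(3)] by simp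
      then show ?thesis using x(1) by blast
    next
      case False
      then show ?thesis using xs(1,2) unfolding partial_play_def complete_play_def by auto
    qed
    then show ?thesis unfolding \<sigma>_def by (rule someI_ex)
  qed
  have "\<not> enforcer_wins_play p H xs"
    if xs: "complete_play H xs" "follows_avoider_strategy p \<sigma> xs" for xs
  proof -
    have dist: "distinct xs" "set xs = verts H" using xs(1) unfolding complete_play_def by auto
    have "P (take n xs)" if "n \<le> length xs" for n
      using that
    proof (induction n)
      case 0
      then show ?case using aw unfolding P_def by simp
    next
      case (Suc n)
      define ys where "ys = take n xs"
      have n: "n < length xs" "length ys = n" using Suc.prems ys_def by auto
      have tk: "take (Suc n) xs = ys @ [xs ! n]" unfolding ys_def using n(1) by (rule take_Suc_conv_app_nth)
      have "distinct (ys @ [xs ! n])" using distinct_take[OF dist(1), of "Suc n"] unfolding tk .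
      then have "xs ! n \<notin> set ys" by simp
      then have new: "xs ! n \<in> verts H - set ys" using nth_mem[OF n(1)] dist(2) by simp
      have pp: "partial_play H ys" "\<not> complete_play H ys"
        using dist new unfolding ys_def partial_play_def complete_play_def by (auto dest: in_set_takeD)
      have Py: "P ys" using Suc ys_def by simp
      show ?case
      proof (cases "mover p (length ys) = Avoider")
        case True
        then have "xs ! n = \<sigma> ys" using xs(2) n unfolding follows_avoider_strategy_def ys_def by simp
        then show ?thesis using \<sigma>[OF pp True] Py tk by simp
      next
        case False
        then show ?thesis using aw_step_Enforcer[OF pp(1) _ False new] Py tk unfolding P_def by simp
      qed
    qed
    from this[of "length xs"] have "aw {} (position p (edges H) xs)" unfolding P_def by (simp add: dist(2))
    then have "{} \<notin> position p (edges H) xs" by (auto elim: aw.cases)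
    then show ?thesis using enforcer_wins_play_position[OF dist(1)] by metis
  qed
  moreover have "avoider_strategy p H \<sigma>" unfolding avoider_strategy_def using \<sigma> by blast
  ultimately show ?thesis unfolding avoider_wins_def by blast
qed

lemma avoider_wins_aw:
  assumes "avoider_wins p H"
  shows "aw (verts H) (edges H)"
proof -
  obtain \<sigma> where \<sigma>: "avoider_strategy p H \<sigma>"
    "\<And>xs. complete_play H xs \<Longrightarrow> follows_avoider_strategy p \<sigma> xs \<Longrightarrow> \<not> enforcer_wins_play p H xs"
    using assms unfolding avoider_wins_def by blast
  have "aw (verts H - set xs) (position p (edges H) xs)"
    if "partial_play H xs" "follows_avoider_strategy p \<sigma> xs" for xs
    using that
  proof (induction "card (verts H - set xs)" arbitrary: xs rule: less_induct)
    case less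
    note pp = less.prems(1)
    have step: "aw (verts H - set xs - {x}) (position p (edges H) (xs @ [x]))"
      if x: "x \<in> verts H - set xs" "mover p (length xs) = Avoider \<Longrightarrow> x = \<sigma> xs" for x
    proof -
      have eq: "verts H - set (xs @ [x]) = verts H - set xs - {x}" by auto
      have "card (verts H - set (xs @ [x])) < card (verts H - set xs)"
        unfolding eq using fin x(1) by (intro card_Diff1_less) auto
      moreover have "partial_play H (xs @ [x])" using pp x(1) unfolding partial_play_def by auto
      moreover have "follows_avoider_strategy p \<sigma> (xs @ [x])"
        unfolding follows_snoc using less.prems(2) x(2) by blast
      ultimately show ?thesis using less.hyps[of "xs @ [x]"] unfolding eq by blast
    qed
    show ?case
    proof (cases "verts H - set xs = {}")
      case True
      then have "complete_play H xs" using pp unfolding partial_play_def complete_play_def by blast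
      moreover have "distinct xs" using pp unfolding partial_play_def by blast
      ultimately have "{} \<notin> position p (edges H) xs"
        using \<sigma>(2) less.prems(2) enforcer_wins_play_position by blast
      then show ?thesis unfolding True by (rule aw_empty)
    next
      case False
      show ?thesis
      proof (cases "mover p (length xs) = Avoider")
        case True
        have "\<not> complete_play H xs" using False unfolding complete_play_def by blast
        then have x: "\<sigma> xs \<in> verts H - set xs" using \<sigma>(1) pp True unfolding avoider_strategy_def by blast
        show ?thesis
          by (rule aw_avoider[OF _ x])
            (use mover_remaining[OF pp] True step[OF x] position_Avoider[OF True] in auto)
      next
        case nA: False
        then have m: "mover p (length xs) = Enforcer" by (cases "mover p (length xs)") auto
        show ?thesis
        proof (rule aw_enforcer)
          show "finite (verts H - set xs)" using fin by simp
          show "even (card (verts H - set xs))" using mover_remaining[OF pp] nA by blast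
          fix x assume x: "x \<in> verts H - set xs"
          then show "aw (verts H - set xs - {x}) {e \<in> position p (edges H) xs. x \<notin> e}"
            using step[OF x] nA position_Enforcer[OF m, of x] by auto
        qed (use False in blast)
      qed
    qed
  qed
  from this[of "[]"] show ?thesis by (simp add: partial_play_def follows_avoider_strategy_def)
qed

end

theorem avoider_wins_as_last_iff_aw:
  assumes "hypergraph H"
  shows "avoider_wins_as_last H \<longleftrightarrow> aw (verts H) (edges H)"
proof -
  have fin: "finite (verts H)" using assms by (simp add: hypergraph_def)
  have "\<exists>p. last_player p H = Avoider"
    unfolding last_player_def by (cases "odd (card (verts H))") (auto intro: exI[of _ Enforcer])
  then show ?thesis
    unfolding avoider_wins_as_last_def using aw_avoider_wins[OF fin] avoider_wins_aw[OF fin] by blast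
qed

lemma chain_betweenE:
  assumes "chain_between a b l P"
  obtains es where "a \<noteq> b" "length es = l" "edges P = set es" "verts P = \<Union>(set es)"
    "simple_walk P es" "linear_walk P es" "\<forall>e\<in>set es. card e = 3"
    "{e \<in> edges P. a \<in> e} = {hd es}" "{e \<in> edges P. b \<in> e} = {last es}"
  using assms unfolding chain_between_def by (elim conjE exE) (rule that; assumption)

text \<open>Processing the edges along the chain, each one keeps at least two vertices that are neither
  \<open>a\<close> nor in an earlier edge; \<open>a\<close> itself is left over for the edge that closes the cycle.\<close>

lemma aw_chain:
  assumes "chain_between a b l P"
  shows "\<exists>G. aw (verts P - {a}) G \<and> G \<subseteq> Pow (verts P - {a}) \<and> (\<forall>e\<in>edges P. \<exists>g\<in>G. g \<subseteq> e)"
proof -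
  obtain es where "a \<noteq> b" "length es = l" and es: "edges P = set es" "verts P = \<Union>(set es)"
    "simple_walk P es" "linear_walk P es" "\<forall>e\<in>set es. card e = 3"
    "{e \<in> edges P. a \<in> e} = {hd es}" and "{e \<in> edges P. b \<in> e} = {last es}"
    using assms by (rule chain_betweenE)
  have ne: "es \<noteq> []" "distinct es" and lin: "linear_edges (set es)"
    using es(4) unfolding linear_walk_def walk_def by auto
  have fine: "finite e" if "e \<in> set es" for e using es(5) that by (intro card_ge_0_finite) simp
  have "\<exists>G. aw (\<Union>(set (take (Suc n) es)) - {a}) G \<and> G \<subseteq> Pow (\<Union>(set (take (Suc n) es)) - {a}) \<and>
      (\<forall>e\<in>set (take (Suc n) es). \<exists>g\<in>G. g \<subseteq> e)" if "Suc n \<le> length es" for n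
    using that
  proof (induction n)
    case 0
    define e where "e = hd es"
    have "take (Suc 0) es = [e]" using ne e_def by (cases es) auto
    moreover have "a \<in> e" "card e = 3" "finite e" using es(5,6) ne fine e_def by auto
    then have "aw (e - {a}) {e - {a}}" by (intro aw_big_edge) simp
    ultimately show ?case by (intro exI[of _ "{e - {a}}"]) auto
  next
    case (Suc n)
    define U where "U = \<Union>(set (take (Suc n) es))"
    define e where "e = es ! Suc n"
    obtain G where G: "aw (U - {a}) G" "G \<subseteq> Pow (U - {a})" "\<forall>e\<in>set (take (Suc n) es). \<exists>g\<in>G. g \<subseteq> e"
      using Suc U_def by auto
    have len: "Suc n < length es" using Suc.prems by simp
    have e: "e \<in> set es" "e \<noteq> hd es" "e \<noteq> es ! n"
      using len ne e_def by (auto simp: hd_conv_nth nth_eq_iff_index_eq)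
    have a: "a \<notin> e" using e es(1,6) by auto
    have tk: "take (Suc (Suc n)) es = take (Suc n) es @ [e]" unfolding e_def using len by (rule take_Suc_conv_app_nth)
    have "e \<inter> U \<subseteq> e \<inter> es ! n"
    proof
      fix y assume "y \<in> e \<inter> U"
      then obtain j where j: "j \<le> n" "y \<in> es ! j" "y \<in> e"
        unfolding U_def using len by (auto simp: in_set_conv_nth less_Suc_eq_le)
      have "es ! j \<inter> es ! Suc n = {}" if "j + 2 \<le> Suc n"
        using es(3) len that unfolding simple_walk_def by blast
      then have "j = n" using j e_def by fastforce
      then show "y \<in> e \<inter> es ! n" using j by blast
    qed
    moreover have "card (e \<inter> es ! n) \<le> 1" using linear_edges_def lin e len by (metis Suc_lessD nth_mem)
    ultimately have "card (e \<inter> U) \<le> 1" using card_mono[of "e \<inter> es ! n" "e \<inter> U"] fine[OF e(1)] by force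
    moreover have "card (e \<inter> U) + card (e - U) = 3" using card_Int_Diff[OF fine[OF e(1)]] es(5) e(1) by metis
    ultimately have big: "aw (e - U) {e - U}" by (intro aw_big_edge) linarith
    have "aw ((U - {a}) \<union> (e - U)) (G \<union> {e - U})"
      by (rule aw_Un[OF G(1) big]) (use G(2) in auto)
    moreover have "(U - {a}) \<union> (e - U) = \<Union>(set (take (Suc (Suc n)) es)) - {a}"
      unfolding tk U_def using a by auto
    ultimately have "aw (\<Union>(set (take (Suc (Suc n)) es)) - {a}) (G \<union> {e - U})" by simp
    moreover have "G \<union> {e - U} \<subseteq> Pow (\<Union>(set (take (Suc (Suc n)) es)) - {a})"
      using G(2) a unfolding tk U_def by auto
    moreover have "\<forall>f\<in>set (take (Suc (Suc n)) es). \<exists>g\<in>G \<union> {e - U}. g \<subseteq> f"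
      using G(3) unfolding tk by auto
    ultimately show ?case by blast
  qed
  from this[of "length es - 1"] show ?thesis using ne es(1,2) by simp
qed

lemma aw_cycle:
  assumes "is_cycle C"
  shows "aw (verts C) (edges C)"
proof -
  obtain a b c l P where P: "chain_between a b l P" "c \<notin> verts P"
    "C = \<lparr>verts = insert c (verts P), edges = insert {a, b, c} (edges P)\<rparr>"
    using assms unfolding is_cycle_def by blast
  obtain G where G: "aw (verts P - {a}) G" "G \<subseteq> Pow (verts P - {a})" "\<forall>e\<in>edges P. \<exists>g\<in>G. g \<subseteq> e"
    using aw_chain[OF P(1)] by blast
  have "a \<in> verts P" using P(1)
  proof (rule chain_betweenE)
    fix es assume "verts P = \<Union>(set es)" "edges P = set es" "{e \<in> edges P. a \<in> e} = {hd es}"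
    then show "a \<in> verts P" by blast
  qed
  then have "a \<noteq> c" "verts P - {a} \<union> {a, c} = verts C" using P(2,3) by auto
  moreover have "aw (verts P - {a} \<union> {a, c}) (G \<union> {{a, c}})"
    by (rule aw_Un[OF G(1) aw_pair]) (use G(2) P(2) \<open>a \<noteq> c\<close> in auto)
  ultimately have "aw (verts C) (G \<union> {{a, c}})" by simp
  then show ?thesis by (rule aw_refine) (use G(3) P(3) in auto)
qed

lemma aw_two_pairs:
  assumes "finite V" "{p, q, r, s} \<subseteq> V" "distinct [p, q, r, s]" "\<And>e. e \<in> F \<Longrightarrow> {p, q} \<subseteq> e \<or> {r, s} \<subseteq> e"
  shows "aw V F"
proof -
  have "aw ({p, q} \<union> {r, s}) ({{p, q}} \<union> {{r, s}})"
    by (intro aw_Un aw_pair) (use assms(3) in auto)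
  then have "aw (({p, q} \<union> {r, s}) \<union> (V - {p, q, r, s})) (({{p, q}} \<union> {{r, s}}) \<union> {})"
    by (rule aw_Un[OF _ aw_no_edges]) (use assms(1) in auto)
  moreover have "({p, q} \<union> {r, s}) \<union> (V - {p, q, r, s}) = V" using assms(2) by auto
  ultimately have "aw V (({{p, q}} \<union> {{r, s}}) \<union> {})" by simp
  then show ?thesis by (rule aw_refine) (use assms(4) in auto)
qed

lemma aw_prism_explicit:
  assumes "distinct [a, b, c, d, e, f]"
  shows "aw {a, b, c, d, e, f} {{a, b, d}, {b, c, e}, {a, c, f}, {d, e, f}}" (is "aw ?V ?F")
proof (rule aw_enforcer)
  have "card ?V = 6" using assms by simp
  then show "even (card ?V)" by simp
  fix x assume "x \<in> ?V"
  then consider "x = a" | "x = b" | "x = c" | "x = d" | "x = e" | "x = f" by blast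
  then show "aw (?V - {x}) {g \<in> ?F. x \<notin> g}"
  proof cases
    case 1
    then show ?thesis using assms by (intro aw_two_pairs[of _ b c d f]) auto
  next
    case 2
    then show ?thesis using assms by (intro aw_two_pairs[of _ a c d e]) auto
  next
    case 3
    then show ?thesis using assms by (intro aw_two_pairs[of _ a b e f]) auto
  next
    case 4
    then show ?thesis using assms by (intro aw_two_pairs[of _ b e a f]) auto
  next
    case 5
    then show ?thesis using assms by (intro aw_two_pairs[of _ b d c f]) auto
  next
    case 6
    then show ?thesis using assms by (intro aw_two_pairs[of _ a d c e]) auto
  qed
qed auto

lemma card_3_obtain:
  assumes "card e = 3" "x \<in> e" "y \<in> e" "x \<noteq> y"
  obtains z where "e = {x, y, z}" "z \<noteq> x" "z \<noteq> y"
proof -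
  have "finite e" using assms(1) by (intro card_ge_0_finite) simp
  then have "card (e - {x, y}) = 1" using assms by (simp add: card_Diff_subset)
  then obtain z where "e - {x, y} = {z}" using card_1_singletonE by blast
  then show ?thesis using that[of z] assms by blast
qed

lemma card_filter_3:
  assumes "X \<noteq> Y" "X \<noteq> Z" "Y \<noteq> Z"
  shows "card {e \<in> {X, Y, Z}. w \<in> e} =
    (if w \<in> X then 1 else 0) + (if w \<in> Y then 1 else 0) + (if w \<in> Z then 1 else 0)"
proof -
  have filter: "{e \<in> insert X A. w \<in> e} = (if w \<in> X then insert X {e \<in> A. w \<in> e} else {e \<in> A. w \<in> e})"
    for X A by auto
  show ?thesis unfolding filter using assms by simp
qed

lemma aw_prism:
  assumes "is_prism Q"
  shows "aw (verts Q) (edges Q)"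
proof -
  obtain C where C: "is_cycle C" "card (edges C) = 3"
    "Q = \<lparr>verts = verts C, edges = insert {v \<in> verts C. vdegree C v = 1} (edges C)\<rparr>"
    using assms unfolding is_prism_def by blast
  obtain a b c l P where P: "chain_between a b l P" "c \<notin> verts P"
    "C = \<lparr>verts = insert c (verts P), edges = insert {a, b, c} (edges P)\<rparr>"
    using C(1) unfolding is_cycle_def by blast
  obtain es where ab: "a \<noteq> b" and es: "length es = l" "edges P = set es" "verts P = \<Union>(set es)"
    "simple_walk P es" "linear_walk P es" "\<forall>e\<in>set es. card e = 3"
    "{e \<in> edges P. a \<in> e} = {hd es}" "{e \<in> edges P. b \<in> e} = {last es}"
    using P(1) by (rule chain_betweenE)
  have "{a, b, c} \<notin> set es" using P(2) es(3) by blast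
  moreover have "distinct es" using es(5) unfolding linear_walk_def by blast
  ultimately have "card (edges C) = Suc (length es)" using P(3) es(2) by (simp add: distinct_card)
  then have "length es = Suc (Suc 0)" using C(2) by simp
  then obtain s t where st: "es = [s, t]" by (metis length_0_conv length_Suc_conv)
  have neq: "s \<noteq> t" using \<open>distinct es\<close> st by simp
  have ends: "a \<in> s" "a \<notin> t" "b \<in> t" "b \<notin> s" using es(2,7,8) neq unfolding st by auto
  have "s \<inter> t \<noteq> {}" using es(5) unfolding linear_walk_def walk_def st by auto
  then obtain v where v: "v \<in> s" "v \<in> t" by blast
  have "card (s \<inter> t) \<le> 1"
    using es(5) neq unfolding linear_walk_def linear_edges_def st by auto
  have s3: "card s = 3" and t3: "card t = 3" using es(6) unfolding st by auto
  have "a \<noteq> v" "v \<noteq> b" using v ends by auto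
  obtain m where m: "s = {a, v, m}" "m \<noteq> a" "m \<noteq> v"
    using card_3_obtain[OF s3 ends(1) v(1) \<open>a \<noteq> v\<close>] .
  obtain n where n: "t = {v, b, n}" "n \<noteq> v" "n \<noteq> b"
    using card_3_obtain[OF t3 v(2) ends(3) \<open>v \<noteq> b\<close>] .
  have "m \<noteq> n"
  proof
    assume "m = n"
    then have "{v, m} \<subseteq> s \<inter> t" using m n by blast
    then have "card {v, m} \<le> card (s \<inter> t)" unfolding m(1) by (intro card_mono) auto
    then show False using \<open>card (s \<inter> t) \<le> 1\<close> m(3) by simp
  qed
  have "c \<notin> s" "c \<notin> t" using P(2) es(3) unfolding st by auto
  then have dist: "distinct [a, v, b, m, n, c]"
    using m n ends \<open>m \<noteq> n\<close> ab by auto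
  have vC: "verts C = {a, v, b, m, n, c}" using P(3) es(3) unfolding st m(1) n(1) by auto
  have eC: "edges C = {{a, v, m}, {v, b, n}, {a, b, c}}" using P(3) es(2) unfolding st m(1) n(1) by auto
  have ne: "{a, v, m} \<noteq> {v, b, n}" "{a, v, m} \<noteq> {a, b, c}" "{v, b, n} \<noteq> {a, b, c}"
    using dist by auto
  have deg: "vdegree C w = (if w \<in> {a, v, m} then 1 else 0) + (if w \<in> {v, b, n} then 1 else 0) + (if w \<in> {a, b, c} then 1 else 0)" for w
    unfolding vdegree_def eC by (rule card_filter_3[OF ne])
  have "{w \<in> verts C. vdegree C w = 1} = {m, n, c}"
    unfolding vC deg using dist by auto
  then have "edges Q = {{a, v, m}, {v, b, n}, {a, b, c}, {m, n, c}}" "verts Q = {a, v, b, m, n, c}"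
    using C(3) eC vC by auto
  then show ?thesis using aw_prism_explicit[OF dist] by simp
qed

lemma aw_listed_component:
  assumes "is_cycle C \<or> is_prism C \<or> is_isolated_2_edge C \<or> is_isolated_vertex C"
  shows "aw (verts C) (edges C)"
  using assms aw_cycle[of C] aw_prism[of C] aw_pair aw_no_edges[of "verts C"]
  unfolding is_isolated_2_edge_def is_isolated_vertex_def by auto

section \<open>Connected components\<close>

definition linked :: "'a set set \<Rightarrow> ('a \<times> 'a) set" where
  "linked F = {(v, w). \<exists>e\<in>F. v \<in> e \<and> w \<in> e}"

definition cls :: "'a hypergraph \<Rightarrow> 'a \<Rightarrow> 'a set" where
  "cls H v = (linked (edges H))\<^sup>* `` {v}"

definition part :: "'a hypergraph \<Rightarrow> 'a \<Rightarrow> 'a hypergraph" where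
  "part H v = \<lparr>verts = cls H v, edges = {e \<in> edges H. e \<subseteq> cls H v}\<rparr>"

lemma self_in_cls [simp]: "v \<in> cls H v"
  by (simp add: cls_def)

lemma cls_step: "y \<in> cls H v \<Longrightarrow> e \<in> edges H \<Longrightarrow> y \<in> e \<Longrightarrow> z \<in> e \<Longrightarrow> z \<in> cls H v"
  unfolding cls_def linked_def by (auto intro: rtrancl_into_rtrancl)

lemma edge_subset_cls: "e \<in> edges H \<Longrightarrow> y \<in> e \<Longrightarrow> y \<in> cls H v \<Longrightarrow> e \<subseteq> cls H v"
  by (auto intro: cls_step)

lemma cls_eq:
  assumes "w \<in> cls H v"
  shows "cls H w = cls H v"
proof -
  have "sym (linked (edges H))" unfolding linked_def sym_def by blast
  then have "sym ((linked (edges H))\<^sup>*)" by (rule sym_rtrancl)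
  then have "(w, v) \<in> (linked (edges H))\<^sup>*" "(v, w) \<in> (linked (edges H))\<^sup>*"
    using assms unfolding cls_def by (auto dest: symD)
  then show ?thesis unfolding cls_def by (auto intro: rtrancl_trans)
qed

lemma cls_disjoint:
  assumes "cls H v \<noteq> cls H w"
  shows "cls H v \<inter> cls H w = {}"
proof (rule ccontr)
  assume "cls H v \<inter> cls H w \<noteq> {}"
  then obtain x where "x \<in> cls H v" "x \<in> cls H w" by blast
  then show False using assms cls_eq by metis
qed

lemma cls_induct [consumes 1, case_names base step]:
  assumes "w \<in> cls H v" "Q v"
    "\<And>y z e. y \<in> cls H v \<Longrightarrow> e \<in> edges H \<Longrightarrow> y \<in> e \<Longrightarrow> z \<in> e \<Longrightarrow> Q y \<Longrightarrow> Q z"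
  shows "Q w"
proof -
  have "(v, w) \<in> (linked (edges H))\<^sup>*" using assms(1) by (simp add: cls_def)
  then show ?thesis
  proof induction
    case (step y z)
    have "y \<in> cls H v" using step.hyps(1) by (simp add: cls_def)
    then show ?case using step.hyps(2) step.IH assms(3) unfolding linked_def by blast
  qed (rule assms(2))
qed

lemma cls_edge:
  assumes "w \<in> cls H v" "w \<noteq> v"
  obtains e where "e \<in> edges H" "v \<in> e"
proof -
  have "(v, w) \<in> (linked (edges H))\<^sup>*" using assms(1) by (simp add: cls_def)
  then show ?thesis
    using assms(2) that unfolding linked_def by (cases rule: converse_rtranclE) auto
qed

lemma walk_mono: "walk C es \<Longrightarrow> edges C \<subseteq> edges H \<Longrightarrow> walk H es"
  unfolding walk_def by blast

lemma walk_in_cls: "walk H es \<Longrightarrow> a \<in> hd es \<Longrightarrow> b \<in> last es \<Longrightarrow> b \<in> cls H a"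
proof (induction es arbitrary: a)
  case Nil
  then show ?case by (simp add: walk_def)
next
  case (Cons e es)
  have e: "e \<in> edges H" "a \<in> e" using Cons.prems by (auto simp: walk_Cons)
  show ?case
  proof (cases "es = []")
    case True
    then show ?thesis using Cons.prems(3) e cls_step[of a H a e b] by simp
  next
    case False
    then obtain c where c: "c \<in> e" "c \<in> hd es" "walk H es" using Cons.prems(1) by (auto simp: walk_Cons)
    then have "c \<in> cls H a" using e cls_step[of a H a e c] by simp
    moreover have "b \<in> cls H c" using Cons.IH[OF c(3,2)] Cons.prems(3) False by simp
    ultimately show ?thesis using cls_eq by metis
  qed
qed

lemma cls_walk:
  assumes "w \<in> cls H v" "w \<noteq> v"
  obtains es where "walk (part H v) es" "v \<in> hd es" "w \<in> last es"
proof -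
  have "w = v \<or> (\<exists>es. walk (part H v) es \<and> v \<in> hd es \<and> w \<in> last es)"
    using assms(1)
  proof (induction rule: cls_induct)
    case (step y z e)
    have e: "e \<in> edges (part H v)"
      using step.hyps edge_subset_cls[of e H y v] by (simp add: part_def)
    then have we: "walk (part H v) [e]" by simp
    from step.IH show ?case
    proof
      assume "y = v"
      then show ?thesis using step.hyps we by (auto intro!: exI[of _ "[e]"])
    next
      assume "\<exists>es. walk (part H v) es \<and> v \<in> hd es \<and> y \<in> last es"
      then obtain es where es: "walk (part H v) es" "v \<in> hd es" "y \<in> last es" by blast
      have "es \<noteq> []" using es(1) by (simp add: walk_def)
      have "walk (part H v) (es @ [e])"
        using es(3) step.hyps by (intro walk_append es(1) we) auto
      then show ?thesis using es(2) step.hyps \<open>es \<noteq> []\<close> by (auto intro!: exI[of _ "es @ [e]"])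
    qed
  qed simp
  then show ?thesis using assms(2) that by blast
qed

lemma connected_part: "connected_hypergraph (part H v)"
  unfolding connected_hypergraph_def
proof (intro ballI impI)
  fix a b assume ab: "a \<in> verts (part H v)" "b \<in> verts (part H v)" "a \<noteq> b"
  then have cls: "cls H a = cls H v" using cls_eq[of a H v] by (simp add: part_def)
  then have "part H a = part H v" by (simp add: part_def)
  moreover have "b \<in> cls H a" using ab(2) cls by (simp add: part_def)
  ultimately show "\<exists>es. walk (part H v) es \<and> a \<in> hd es \<and> b \<in> last es"
    using cls_walk[of b H a] ab(3) by metis
qed

lemma cls_subset_verts:
  assumes "hypergraph H" "v \<in> verts H"
  shows "cls H v \<subseteq> verts H"
proof
  fix w assume "w \<in> cls H v"
  then show "w \<in> verts H"
    by (induction rule: cls_induct) (use assms in \<open>auto simp: hypergraph_def\<close>)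
qed

lemma subhypergraph_part:
  assumes "hypergraph H" "v \<in> verts H"
  shows "subhypergraph (part H v) H"
proof -
  have "cls H v \<subseteq> verts H" using cls_subset_verts[OF assms] .
  then show ?thesis
    using assms(1) finite_subset unfolding subhypergraph_def hypergraph_def part_def by fastforce
qed

lemma connected_sub_part:
  assumes "subhypergraph C H" "connected_hypergraph C" "v \<in> verts C"
  shows "subhypergraph C (part H v)"
proof -
  have C: "hypergraph C" "edges C \<subseteq> edges H" using assms(1) by (auto simp: subhypergraph_def)
  have "verts C \<subseteq> cls H v"
  proof
    fix w assume w: "w \<in> verts C"
    show "w \<in> cls H v"
    proof (cases "w = v")
      case False
      then obtain es where "walk C es" "v \<in> hd es" "w \<in> last es"
        using assms(2,3) w unfolding connected_hypergraph_def by metis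
      then show ?thesis using walk_in_cls[OF walk_mono[OF _ C(2)]] by blast
    qed simp
  qed
  then show ?thesis using C unfolding subhypergraph_def hypergraph_def part_def by auto
qed

lemma connected_component_part:
  assumes "hypergraph H" "v \<in> verts H"
  shows "connected_component H (part H v)"
  unfolding connected_component_def
proof (intro conjI allI impI)
  have v: "v \<in> verts (part H v)" by (simp add: part_def)
  then show "\<not> (verts (part H v) = {} \<and> edges (part H v) = {})" by blast
  fix D assume D: "subhypergraph D H \<and> connected_hypergraph D \<and> subhypergraph (part H v) D"
  then have "v \<in> verts D" using v unfolding subhypergraph_def by blast
  then have "subhypergraph D (part H v)" using connected_sub_part[of D H v] D by blast
  then show "D = part H v" using D unfolding subhypergraph_def by auto
qed (use subhypergraph_part[OF assms] connected_part[of H v] in blast)+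

lemma connected_component_eq_part:
  assumes "hypergraph H" "connected_component H C" "v \<in> verts C"
  shows "C = part H v"
proof -
  have C: "subhypergraph C H" "connected_hypergraph C" "v \<in> verts H"
    using assms(2,3) unfolding connected_component_def subhypergraph_def by auto
  then have "subhypergraph C (part H v)" using connected_sub_part[OF C(1,2) assms(3)] by blast
  then have "part H v = C"
    using assms(2) subhypergraph_part[OF assms(1) C(3)] connected_part[of H v]
    unfolding connected_component_def by blast
  then show ?thesis by simp
qed

lemma aw_components:
  assumes H: "hypergraph H" and comp: "\<And>C. connected_component H C \<Longrightarrow> aw (verts C) (edges C)"
  shows "aw (verts H) (edges H)"
proof (cases "verts H = {}")
  case True
  show ?thesis
  proof (cases "edges H = {}")
    case False
    have "connected_component H H"
      using H True False unfolding connected_component_def subhypergraph_def connected_hypergraph_def by auto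
    then show ?thesis by (rule comp)
  qed (use True aw_no_edges[of "{}"] in simp)
next
  case False
  have aw_cls: "aw (cls H v) {e \<in> edges H. e \<subseteq> cls H v}" if "v \<in> verts H" for v
    using comp[OF connected_component_part[OF H that]] by (simp add: part_def)
  have nonempty: "{} \<notin> edges H"
    using False aw_cls aw_edge_card[where e = "{}"] by fastforce
  have "aw (\<Union>J) (\<Union>K\<in>J. {e \<in> edges H. e \<subseteq> K})" if "finite J" "J \<subseteq> cls H ` verts H" for J
    using that
  proof induction
    case empty
    then show ?case by (simp add: aw_no_edges)
  next
    case (insert K J)
    obtain v where v: "v \<in> verts H" "K = cls H v" using insert.prems by blast
    have "K \<inter> L = {}" if L: "L \<in> J" for L
    proof -
      obtain w where w: "L = cls H w" using insert.prems L by blast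
      have "K \<noteq> L" using insert.hyps(2) L by metis
      then show ?thesis unfolding v(2) w by (rule cls_disjoint)
    qed
    then have disj: "K \<inter> \<Union>J = {}" by blast
    have IH: "aw (\<Union>J) (\<Union>K\<in>J. {e \<in> edges H. e \<subseteq> K})"
      using insert.IH insert.prems by simp
    have "aw (K \<union> \<Union>J) ({e \<in> edges H. e \<subseteq> K} \<union> (\<Union>K\<in>J. {e \<in> edges H. e \<subseteq> K}))"
      by (rule aw_Un[OF aw_cls[OF v(1), folded v(2)] IH disj]) auto
    then show ?case by simp
  qed
  from this[of "cls H ` verts H"]
  have "aw (\<Union>(cls H ` verts H)) (\<Union>K\<in>cls H ` verts H. {e \<in> edges H. e \<subseteq> K})"
    using H by (simp add: hypergraph_def)
  moreover have "\<Union>(cls H ` verts H) = verts H"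
  proof (intro equalityI subsetI)
    fix x assume "x \<in> \<Union>(cls H ` verts H)"
    then show "x \<in> verts H" using cls_subset_verts[OF H] by auto
  qed (auto intro: bexI self_in_cls)
  moreover have "(\<Union>K\<in>cls H ` verts H. {e \<in> edges H. e \<subseteq> K}) = edges H"
  proof (intro equalityI subsetI)
    fix e assume e: "e \<in> edges H"
    then obtain x where x: "x \<in> e" using nonempty by (metis ex_in_conv)
    have "x \<in> verts H" using e x H unfolding hypergraph_def by blast
    moreover have "e \<subseteq> cls H x" by (rule edge_subset_cls[OF e x self_in_cls])
    ultimately show "e \<in> (\<Union>K\<in>cls H ` verts H. {e \<in> edges H. e \<subseteq> K})" using e by auto
  qed auto
  ultimately show ?thesis by simp
qed

lemma private_leaf:
  assumes "g \<in> edges (part H v)" "card g = 3" "card (g - \<Union>(edges (part H v) - {g})) \<ge> 2"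
  shows "leaf_edge H g"
proof -
  define F where "F = edges (part H v)"
  have g: "g \<in> edges H" "g \<subseteq> cls H v" using assms(1) by (auto simp: part_def)
  have fin: "finite g" using assms(2) by (intro card_ge_0_finite) simp
  have "{w \<in> g. vdegree H w > 1} \<subseteq> g \<inter> \<Union>(F - {g})"
  proof
    fix w assume "w \<in> {w \<in> g. vdegree H w > 1}"
    then have w: "w \<in> g" "vdegree H w > 1" by auto
    have "w \<in> \<Union>(F - {g})"
    proof (rule ccontr)
      assume no: "w \<notin> \<Union>(F - {g})"
      have "e = g" if "e \<in> edges H" "w \<in> e" for e
        using edge_subset_cls[OF that, of v] w(1) g(2) that no unfolding F_def part_def by auto
      then have "{e \<in> edges H. w \<in> e} = {g}" using g(1) w(1) by blast
      then show False using w(2) by (simp add: vdegree_def)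
    qed
    then show "w \<in> g \<inter> \<Union>(F - {g})" using w(1) by blast
  qed
  then have "card {w \<in> g. vdegree H w > 1} \<le> card (g \<inter> \<Union>(F - {g}))"
    using fin by (intro card_mono) auto
  moreover have "card (g \<inter> \<Union>(F - {g})) + card (g - \<Union>(F - {g})) = 3"
    using card_Int_Diff[OF fin] assms(2) by metis
  ultimately show ?thesis using assms(3) g(1) unfolding leaf_edge_def F_def by linarith
qed

lemma conn_part:
  assumes "edges (part H v) \<noteq> {}" "{} \<notin> edges H"
  shows "conn (edges (part H v))"
  unfolding conn_def
proof (intro conjI allI impI)
  define F where "F = edges (part H v)"
  have F: "e \<in> F \<longleftrightarrow> e \<in> edges H \<and> e \<subseteq> cls H v" for e by (simp add: F_def part_def)
  fix P assume "P \<subset> edges (part H v) \<and> P \<noteq> {}"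
  then have P: "P \<subset> F" "P \<noteq> {}" unfolding F_def by auto
  obtain e where e: "e \<in> P" using P(2) by blast
  then have "e \<noteq> {}" using F P(1) assms(2) by blast
  then obtain x where x: "x \<in> e" by blast
  have xv: "cls H x = cls H v" using cls_eq[of x H v] F[of e] e P(1) x by blast
  show "\<exists>f\<in>edges (part H v) - P. f \<inter> \<Union>P \<noteq> {}"
  proof (rule ccontr)
    assume no: "\<not> (\<exists>f\<in>edges (part H v) - P. f \<inter> \<Union>P \<noteq> {})"
    have "w \<in> \<Union>P" if "w \<in> cls H x" for w
      using that
    proof (induction rule: cls_induct)
      case base
      then show ?case using e x by blast
    next
      case (step y z g)
      then have "g \<in> F" using F[of g] edge_subset_cls[of g H y v] xv by simp
      then have "g \<in> P" using no step unfolding F_def by blast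
      then show ?case using step by blast
    qed
    then have sub: "cls H v \<subseteq> \<Union>P" using xv by blast
    obtain f where f: "f \<in> F" "f \<notin> P" using P(1) by blast
    have "f \<noteq> {}" "f \<subseteq> cls H v" using F[of f] f(1) assms(2) by auto
    then have "f \<inter> \<Union>P \<noteq> {}" using sub by blast
    then show False using no f unfolding F_def by blast
  qed
qed (rule assms(1))

lemma verts_part:
  assumes "edges (part H v) \<noteq> {}" "{} \<notin> edges H"
  shows "cls H v = \<Union>(edges (part H v))"
proof
  show "\<Union>(edges (part H v)) \<subseteq> cls H v" by (auto simp: part_def)
  show "cls H v \<subseteq> \<Union>(edges (part H v))"
  proof
    fix w assume w: "w \<in> cls H v"
    obtain e where e: "e \<in> edges H" "e \<subseteq> cls H v" using assms(1) by (auto simp: part_def)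
    then obtain x where x: "x \<in> e" "x \<in> cls H v" using assms(2) by (metis ex_in_conv subsetD)
    have "\<exists>f\<in>edges H. w \<in> f"
    proof (cases "x = w")
      case False
      moreover have "x \<in> cls H w" using cls_eq[OF w] x(2) by simp
      ultimately show ?thesis using cls_edge[of x H w] by metis
    qed (use e x in blast)
    then obtain f where "f \<in> edges H" "w \<in> f" by blast
    then show "w \<in> \<Union>(edges (part H v))" using edge_subset_cls[of f H w v] w by (auto simp: part_def)
  qed
qed

lemma part_no_edges:
  assumes "edges (part H v) = {}"
  shows "cls H v = {v}"
proof -
  have "w = v" if w: "w \<in> cls H v" for w
  proof (rule ccontr)
    assume "w \<noteq> v"
    then obtain e where "e \<in> edges H" "v \<in> e" using cls_edge[OF w] by metis
    then show False using edge_subset_cls[of e H v v] assms by (auto simp: part_def)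
  qed
  then have "cls H v \<subseteq> {v}" by auto
  moreover have "{v} \<subseteq> cls H v" by simp
  ultimately show ?thesis by (rule equalityI)
qed

lemma listed_part:
  assumes H: "hypergraph H" "rank3 H" "reduced H" "linear_hypergraph H"
    and aw: "aw (verts H) (edges H)" and v: "v \<in> verts H"
  shows "is_cycle (part H v) \<or> is_prism (part H v) \<or> is_isolated_2_edge (part H v) \<or> is_isolated_vertex (part H v)"
proof -
  define F where "F = edges (part H v)"
  have part: "part H v = \<lparr>verts = cls H v, edges = F\<rparr>" by (simp add: part_def F_def)
  have nonempty: "{} \<notin> edges H" using aw_edge_card[OF aw, of "{}"] by auto
  show ?thesis
  proof (cases "F = {}")
    case True
    then show ?thesis using part_no_edges[of H v] part unfolding F_def is_isolated_vertex_def by auto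
  next
    case ne: False
    have K: "cls H v = \<Union>F" and c: "conn F"
      using verts_part conn_part ne nonempty unfolding F_def by metis+
    have hgF: "part H v = hg F" using part K by simp
    have FH: "F \<subseteq> edges H" unfolding F_def part_def by auto
    have a: "aw_rank3 (\<Union>F) F"
    proof
      have "\<Union>F \<subseteq> verts H" using FH H(1) unfolding hypergraph_def by blast
      then show "aw (\<Union>F) F" by (rule aw_restrict[OF aw _ FH]) blast
      show "linear_edges F" using linear_edges_subset[OF _ FH] H(4) unfolding linear_hypergraph_def by blast
      show "card e \<le> 3" if "e \<in> F" for e using H(2) that FH unfolding rank3_def by blast
    qed auto
    interpret aw_rank3 "\<Union>F" F by (rule a)
    have priv: "card (g - \<Union>(F - {g})) \<le> 1" if "g \<in> F" "card g = 3" for g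
    proof (rule ccontr)
      assume "\<not> card (g - \<Union>(F - {g})) \<le> 1"
      then have "leaf_edge H g" using private_leaf[of g H v] that unfolding F_def by linarith
      then show False using H(3) that(2) unfolding reduced_def by blast
    qed
    show ?thesis
    proof (cases "\<exists>u\<in>F. card u = 2")
      case True
      then obtain u where u: "u \<in> F" "card u = 2" by blast
      have "F = {u}"
      proof (rule ccontr)
        assume "F \<noteq> {u}"
        then have "{u} \<subset> F" using u(1) by blast
        then obtain g where g: "g \<in> F" "g \<notin> {u}" "conn (F - {g})"
          using conn_removable[OF finF c conn_single] by metis
        have gu: "g \<noteq> u" using g(2) by blast
        have "card g \<noteq> 2"
          using aw_conn_2_edge_unique[OF a order_refl c u(1) g(1) u(2)] gu by blast
        then have "card g = 3" using card_edge[OF g(1)] by blast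
        then show False
          using priv[OF g(1)] aw_pendant_edge[OF a order_refl c u g(1) gu g(3)] by linarith
      qed
      moreover obtain a b where "u = {a, b}" "a \<noteq> b" using u(2) by (auto simp: card_2_iff)
      ultimately have "is_isolated_2_edge (part H v)" unfolding hgF is_isolated_2_edge_def by auto
      then show ?thesis by blast
    next
      case False
      then have three: "card e = 3" if "e \<in> F" for e using card_edge[OF that] that by blast
      have "no_leaf F" unfolding no_leaf_def using priv three by blast
      moreover have "odd_trees F"
        unfolding odd_trees_def using aw_conn_odd_tree[OF a] three by (meson subsetD)
      ultimately have "cyclic F \<or> (\<exists>C. cyclic C \<and> card C = 3 \<and> F = insert (degree_one C) C)"
        using no_leaf_cyclic_or_prism[OF finF c lin three] by blast
      then show ?thesis
      proof (elim disjE exE conjE)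
        assume "cyclic F"
        then show ?thesis unfolding cyclic_def hgF by blast
      next
        fix C assume C: "cyclic C" "card C = 3" "F = insert (degree_one C) C"
        have "degree_one C \<subseteq> \<Union>C" unfolding degree_one_def by blast
        then have "\<Union>F = \<Union>C" using C(3) by blast
        moreover have "{v \<in> verts (hg C). vdegree (hg C) v = 1} = degree_one C"
          by (simp add: degree_one_def vdegree_def)
        ultimately have "hg F = \<lparr>verts = verts (hg C),
            edges = insert {v \<in> verts (hg C). vdegree (hg C) v = 1} (edges (hg C))\<rparr>"
          using C(3) by simp
        moreover have "is_cycle (hg C)" "card (edges (hg C)) = 3" using C(1,2) unfolding cyclic_def by auto
        ultimately have "is_prism (hg F)" unfolding is_prism_def by blast
        then show ?thesis unfolding hgF by blast
      qed
    qed
  qed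
qed

theorem theorem4p7:
  fixes H :: "'a hypergraph"
  assumes "hypergraph H"
    and "rank3 H"
    and "reduced H"
    and "linear_hypergraph H"
  shows "avoider_wins_as_last H \<longleftrightarrow>
    (\<forall>C. connected_component H C \<longrightarrow>
       is_cycle C \<or> is_prism C \<or> is_isolated_2_edge C \<or> is_isolated_vertex C)"
proof -
  have "is_cycle C \<or> is_prism C \<or> is_isolated_2_edge C \<or> is_isolated_vertex C"
    if aw: "aw (verts H) (edges H)" and C: "connected_component H C" for C
  proof -
    have sub: "subhypergraph C H" and ne: "\<not> (verts C = {} \<and> edges C = {})"
      using C unfolding connected_component_def by auto
    have "verts C \<noteq> {}"
    proof
      assume empty: "verts C = {}"
      then have "{} \<in> edges C" using sub ne unfolding subhypergraph_def hypergraph_def by auto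
      then have "{} \<in> edges H" using sub unfolding subhypergraph_def by blast
      then show False using aw_edge_card[OF aw] by fastforce
    qed
    then obtain v where v: "v \<in> verts C" by blast
    then have "v \<in> verts H" using sub unfolding subhypergraph_def by blast
    then show ?thesis
      using listed_part[OF assms aw] connected_component_eq_part[OF assms(1) C v] by metis
  qed
  moreover have "aw (verts H) (edges H)"
    if "\<forall>C. connected_component H C \<longrightarrow>
       is_cycle C \<or> is_prism C \<or> is_isolated_2_edge C \<or> is_isolated_vertex C"
    using aw_components[OF assms(1)] aw_listed_component that by metis
  ultimately show ?thesis using avoider_wins_as_last_iff_aw[OF assms(1)] by blast
qed

end
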